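(* There is a randomized algorithm which, given only the vertex set $V$ of an unknown butterfly network $F^h=(V,E)$ of height $h$ (so $|V|=2^h(h+1)$), and access to path queries on $F^h$, determines $E$ using $O(2^{3h/2}h^2)$ path queries with high probability.
   Context: Butterfly networks $F^k$ are defined recursively, each with a designated ordered list of $2^k$ targets. $F^0$ is a single vertex with no edges, which is its own (unique) target. For $k\ge1$, let $F^{k-1}_A=(V_A,E_A)$ and $F^{k-1}_B=(V_B,E_B)$ be two disjoint copies of $F^{k-1}$, each with $m=2^{k-1}$ targets, namely $t_0,\dots,t_{m-1}\in V_A$ and $t_m,\dots,t_{2m-1}\in V_B$. Let $v_0,\dots,v_{2m-1}$ be $2m$ new vertices. Then $F^k$ has vertex set $V_A\cup V_B\cup\{v_0,\dots,v_{2m-1}\}$ and edge set $E_A\cup E_B\cup\bigcup_{0\le i\le m-1}\{(t_i,v_i),(t_i,v_{i+m}),(t_{i+m},v_i),(t_{i+m},v_{i+m})\}$ (directed edges), and its targets are $v_0,\dots,v_{2m-1}$. A butterfly network of height $h$ is $F^h$. A path query $\mathsf{path}(u,v)$ returns $1$ if there is a directed path from $u$ to $v$ and $0$ otherwise; the algorithm initially knows only $V$ and its cost is the number of path queries. "With high probability" means with probability at least $1-1/n^{c}$ for some constant $c\ge1$, where $n=|V|$. *)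

theory Defs
  imports "HOL-Probability.Probability" "HOL-Library.Landau_Symbols"
begin

text \<open>
  \<open>butterfly k V E ts\<close>: the digraph \<open>(V, E)\<close> is a copy of the butterfly network of height \<open>k\<close>,
  with ordered list of targets \<open>ts\<close>. The vertices are arbitrary elements of the type \<open>'v\<close>, so
  all labelled copies of the network are covered.
\<close>

inductive butterfly :: "nat \<Rightarrow> 'v set \<Rightarrow> ('v \<times> 'v) set \<Rightarrow> 'v list \<Rightarrow> bool" where
  base: "butterfly 0 {v} {} [v]"
| step: "\<lbrakk>butterfly k VA EA ta; butterfly k VB EB tb; VA \<inter> VB = {};
     m = 2 ^ k; t = ta @ tb;
     length v = 2 * m; distinct v; set v \<inter> (VA \<union> VB) = {}\<rbrakk>
   \<Longrightarrow> butterfly (Suc k) (VA \<union> VB \<union> set v)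
        (EA \<union> EB \<union> (\<Union>i\<in>{0..<m}. {(t ! i, v ! i), (t ! i, v ! (i + m)),
                                   (t ! (i + m), v ! i), (t ! (i + m), v ! (i + m))}))
        v"

definition butterfly_network :: "nat \<Rightarrow> 'v set \<Rightarrow> ('v \<times> 'v) set \<Rightarrow> bool" where
  "butterfly_network h V E \<longleftrightarrow> (\<exists>ts. butterfly h V E ts)"

lemma butterfly_length: "butterfly k V E ts \<Longrightarrow> length ts = 2 ^ k"
  by (induction rule: butterfly.induct) auto

lemma butterfly_targets: "butterfly k V E ts \<Longrightarrow> distinct ts \<and> set ts \<subseteq> V"
  by (induction rule: butterfly.induct) auto

lemma butterfly_finite_card:
  "butterfly k V E ts \<Longrightarrow> finite V \<and> card V = 2 ^ k * (k + 1)"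
proof (induction rule: butterfly.induct)
  case (step k VA EA ta VB EB tb m t v)
  have "card (VA \<union> VB \<union> set v) = card (VA \<union> VB) + card (set v)"
    by (rule card_Un_disjoint) (use step.IH step.hyps in auto)
  also have "card (VA \<union> VB) = card VA + card VB"
    by (rule card_Un_disjoint) (use step.IH step.hyps in auto)
  also have "card (set v) = 2 * 2 ^ k"
    using distinct_card[OF \<open>distinct v\<close>] \<open>length v = 2 * m\<close> \<open>m = 2 ^ k\<close> by simp
  finally have "card (VA \<union> VB \<union> set v) = 2 ^ Suc k * (Suc k + 1)"
    using step.IH by simp
  then show ?case
    using step.IH by simp
qed simp

lemma butterfly_edges: "butterfly k V E ts \<Longrightarrow> E \<subseteq> V \<times> V"
proof (induction rule: butterfly.induct)
  case (step k VA EA ta VB EB tb m t v)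
  have len: "length t = 2 * m"
    using butterfly_length[OF step.hyps(1)] butterfly_length[OF step.hyps(2)]
      \<open>m = 2 ^ k\<close> \<open>t = ta @ tb\<close> by simp
  have sub: "set t \<subseteq> VA \<union> VB"
    using butterfly_targets[OF step.hyps(1)] butterfly_targets[OF step.hyps(2)]
      \<open>t = ta @ tb\<close> by auto
  let ?W = "VA \<union> VB \<union> set v"
  have t: "t ! i \<in> ?W" if "i < 2 * m" for i
    using subsetD[OF sub nth_mem[of i t]] that len by auto
  have v: "v ! i \<in> ?W" if "i < 2 * m" for i
    using nth_mem[of i v] that \<open>length v = 2 * m\<close> by simp
  have "{(t ! i, v ! i), (t ! i, v ! (i + m)), (t ! (i + m), v ! i), (t ! (i + m), v ! (i + m))}
      \<subseteq> ?W \<times> ?W" if "i < m" for i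
    using that t[of i] t[of "i + m"] v[of i] v[of "i + m"] by simp
  then have "(\<Union>i\<in>{0..<m}. {(t ! i, v ! i), (t ! i, v ! (i + m)),
      (t ! (i + m), v ! i), (t ! (i + m), v ! (i + m))}) \<subseteq> ?W \<times> ?W"
    by (intro UN_least) simp
  moreover have "EA \<subseteq> ?W \<times> ?W" "EB \<subseteq> ?W \<times> ?W"
    using step.IH by blast+
  ultimately show ?case
    by (intro Un_least)
qed simp

lemma butterfly_network_card:
  "butterfly_network h V E \<Longrightarrow> card V = 2 ^ h * (h + 1)"
  unfolding butterfly_network_def using butterfly_finite_card by blast

definition path_query :: "('v \<times> 'v) set \<Rightarrow> 'v \<Rightarrow> 'v \<Rightarrow> bool" where
  "path_query E u v \<longleftrightarrow> (u, v) \<in> E\<^sup>*"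

text \<open>
  A deterministic adaptive query algorithm is a decision tree: it either stops and outputs an edge
  set, or asks a query about an ordered pair of vertices and continues depending on the answer.
  A randomized algorithm is a probability distribution on such trees.
\<close>

datatype 'v query_tree =
    Output "('v \<times> 'v) set"
  | Query 'v 'v "bool \<Rightarrow> 'v query_tree"

primrec tree_output :: "('v \<Rightarrow> 'v \<Rightarrow> bool) \<Rightarrow> 'v query_tree \<Rightarrow> ('v \<times> 'v) set" where
  "tree_output ans (Output F) = F"
| "tree_output ans (Query u v T) = tree_output ans (T (ans u v))"

primrec num_queries :: "('v \<Rightarrow> 'v \<Rightarrow> bool) \<Rightarrow> 'v query_tree \<Rightarrow> nat" where
  "num_queries ans (Output F) = 0"
| "num_queries ans (Query u v T) = Suc (num_queries ans (T (ans u v)))"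

end

theory Submission
  imports Defs
begin

text \<open>
  The algorithm is deterministic. Give every vertex a level and \<open>h\<close> bits such that \<open>v\<close> is reachable
  from \<open>u\<close> iff \<open>lev u \<le> lev v\<close> and the bits agree outside \<open>{lev u..<lev v}\<close>. Cut the network at level
  \<open>m = h div 2\<close>: the vertices of level at most \<open>m\<close> form \<open>2\<^sup>h\<^sup>-\<^sup>m\<close> disjoint lower butterflies (fixed by the
  bits from \<open>m\<close> on), those of level at least \<open>m\<close> form \<open>2\<^sup>m\<close> upper ones (fixed by the bits below \<open>m\<close>).
  Each has only about \<open>2\<^sup>h\<^sup>/\<^sup>2 h\<close> vertices, so once they are known, querying all pairs
  inside them is affordable and reveals \<open>E\<close> as a covering relation.

  To separate the lower butterflies, find a set \<open>S\<close> with one source in each of them, at a price of \<open>O(|V|)\<close> per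
  source: fix a target \<open>t\<close>; after finding a source \<open>s\<close>, the level-\<open>m\<close> vertex \<open>p\<close> on the unique path
  from \<open>s\<close> to \<open>t\<close> can be identified, and every source below a vertex that lies below \<open>t\<close> and is
  incomparable to all such \<open>p\<close> belongs to a new lower butterfly. Dually, find a set \<open>T\<close> of targets,
  one in each upper butterfly. The vertices of level \<open>m\<close> are exactly those above a unique source of \<open>S\<close> and
  below a unique target of \<open>T\<close>. A lower vertex \<open>v\<close> is assigned to its butterfly by choosing some
  \<open>t \<in> T\<close> above it and comparing \<open>v\<close> with the \<open>2\<^sup>h\<^sup>-\<^sup>m\<close> vertices of level \<open>m\<close> below \<open>t\<close>.
\<close>

section \<open>Obtaining information by queries\<close>

text \<open>Within \<open>k\<close> queries, an \<open>x\<close> with \<open>R E x\<close> can be obtained for every \<open>E \<in> P\<close>. Trees can only output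
  edge sets, so "obtaining \<open>x\<close>" is expressed in continuation-passing style: whatever tree \<open>cont x\<close>
  is to be run once \<open>x\<close> is known, some tree simulates it at the price of \<open>k\<close> further queries.\<close>

definition finds :: "('v \<times> 'v) set set \<Rightarrow> nat \<Rightarrow> (('v \<times> 'v) set \<Rightarrow> 'x \<Rightarrow> bool) \<Rightarrow> bool" where
  "finds P k R \<longleftrightarrow> (\<forall>cont. \<exists>T. \<forall>E\<in>P. \<exists>x. R E x
     \<and> tree_output (path_query E) T = tree_output (path_query E) (cont x)
     \<and> num_queries (path_query E) T \<le> k + num_queries (path_query E) (cont x))"

lemma finds_return: "(\<And>E. E \<in> P \<Longrightarrow> R E x) \<Longrightarrow> finds P 0 R"
  unfolding finds_def by (intro allI, rule_tac x = "cont x" in exI) auto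

text \<open>Covers results that no graph of the family yields. In the remaining case some consistent
  graph exists, and its coordinates bound the sizes of the sets to be queried.\<close>

lemma finds_empty: "finds {} k R"
  unfolding finds_def by simp

text \<open>Sequential composition: trees for the second task, one chosen for each \<open>x\<close>,
  serve as continuation of the first. The second task may assume \<open>R E x\<close> because the
  \<open>x\<close> handed on for a graph \<open>E\<close> satisfies it.\<close>

lemma finds_bind:
  assumes "finds P k R" and "\<And>x. finds {E \<in> P. R E x} l Q"
  shows "finds P (k + l) Q"
  unfolding finds_def
proof
  fix cont
  define good where "good x T \<longleftrightarrow> (\<forall>E\<in>{E \<in> P. R E x}. \<exists>y. Q E y
     \<and> tree_output (path_query E) T = tree_output (path_query E) (cont y)
     \<and> num_queries (path_query E) T \<le> l + num_queries (path_query E) (cont y))" for x T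
  have "\<forall>x. \<exists>T. good x T"
    using assms(2) unfolding finds_def good_def by blast
  then obtain U where "\<And>x. good x (U x)"
    by metis
  note U = this[unfolded good_def]
  obtain T where T: "\<forall>E\<in>P. \<exists>x. R E x
     \<and> tree_output (path_query E) T = tree_output (path_query E) (U x)
     \<and> num_queries (path_query E) T \<le> k + num_queries (path_query E) (U x)"
    using assms(1) unfolding finds_def by blast
  show "\<exists>T. \<forall>E\<in>P. \<exists>y. Q E y
     \<and> tree_output (path_query E) T = tree_output (path_query E) (cont y)
     \<and> num_queries (path_query E) T \<le> k + l + num_queries (path_query E) (cont y)"
  proof (intro exI[of _ T] ballI)
    fix E assume E: "E \<in> P"
    then obtain x where x: "R E x"
      "tree_output (path_query E) T = tree_output (path_query E) (U x)"
      "num_queries (path_query E) T \<le> k + num_queries (path_query E) (U x)"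
      using T by blast
    then obtain y where "Q E y"
      "tree_output (path_query E) (U x) = tree_output (path_query E) (cont y)"
      "num_queries (path_query E) (U x) \<le> l + num_queries (path_query E) (cont y)"
      using U[of x] E by blast
    with x show "\<exists>y. Q E y
       \<and> tree_output (path_query E) T = tree_output (path_query E) (cont y)
       \<and> num_queries (path_query E) T \<le> k + l + num_queries (path_query E) (cont y)"
      by (intro exI[of _ y] conjI) (assumption, simp, linarith)
  qed
qed

text \<open>Computation between queries is free, but \<open>f\<close> does not see \<open>E\<close>:
  every deduction must be a function of what has been obtained.\<close>

lemma finds_map:
  assumes "finds P k R" and "\<And>E x. E \<in> P \<Longrightarrow> R E x \<Longrightarrow> Q E (f x)"
  shows "finds P k Q"
proof -
  have "finds {E \<in> P. R E x} 0 Q" for x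
    by (rule finds_return[where x = "f x"]) (use assms(2) in auto)
  from finds_bind[OF assms(1) this] show ?thesis
    by simp
qed

lemma finds_mono:
  assumes "finds P k R" and "k \<le> l"
  shows "finds P l R"
  unfolding finds_def
proof
  fix cont
  show "\<exists>T. \<forall>E\<in>P. \<exists>x. R E x
     \<and> tree_output (path_query E) T = tree_output (path_query E) (cont x)
     \<and> num_queries (path_query E) T \<le> l + num_queries (path_query E) (cont x)"
  proof -
    obtain T where T: "\<forall>E\<in>P. \<exists>x. R E x
       \<and> tree_output (path_query E) T = tree_output (path_query E) (cont x)
       \<and> num_queries (path_query E) T \<le> k + num_queries (path_query E) (cont x)"
      using assms(1) unfolding finds_def by blast
    show ?thesis
      using T assms(2) by (meson add_le_mono1 le_trans)
  qed
qed

text \<open>Lets a tree made for a graph run on the reversed graph. The output is reversed too,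
  since it has to be an edge set of the graph at hand.\<close>

primrec swap_queries :: "'v query_tree \<Rightarrow> 'v query_tree" where
  "swap_queries (Output F) = Output (F\<inverse>)"
| "swap_queries (Query u v T) = Query v u (\<lambda>b. swap_queries (T b))"

lemma finds_converse:
  fixes P :: "('v \<times> 'v) set set"
  assumes "finds P k R"
  shows "finds (converse ` P) k (\<lambda>E. R (E\<inverse>))"
proof -
  have pq [simp]: "path_query (E\<inverse>) u v \<longleftrightarrow> path_query E v u" for E :: "('v \<times> 'v) set" and u v
    by (simp add: path_query_def rtrancl_converse)
  have out: "tree_output (path_query (E\<inverse>)) (swap_queries T) = (tree_output (path_query E) T)\<inverse>"
    for E :: "('v \<times> 'v) set" and T by (induction T) auto
  have num: "num_queries (path_query (E\<inverse>)) (swap_queries T) = num_queries (path_query E) T"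
    for E :: "('v \<times> 'v) set" and T by (induction T) auto
  have ff: "swap_queries (swap_queries T) = T" for T :: "'v query_tree" by (induction T) auto
  show ?thesis
    unfolding finds_def
  proof
    fix cont
    \<comment> \<open>The continuation is reversed before \<open>T\<close> is obtained and
      \<open>T\<close> afterwards; the two reversals cancel by \<open>ff\<close>.\<close>
    obtain T where T: "\<forall>E\<in>P. \<exists>x. R E x
       \<and> tree_output (path_query E) T = tree_output (path_query E) (swap_queries (cont x))
       \<and> num_queries (path_query E) T \<le> k + num_queries (path_query E) (swap_queries (cont x))"
      using spec[OF assms[unfolded finds_def], of "\<lambda>x. swap_queries (cont x)"] by blast
    show "\<exists>T. \<forall>E\<in>converse ` P. \<exists>x. R (E\<inverse>) x
       \<and> tree_output (path_query E) T = tree_output (path_query E) (cont x)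
       \<and> num_queries (path_query E) T \<le> k + num_queries (path_query E) (cont x)"
    proof (intro exI[of _ "swap_queries T"] ballI)
      fix E assume "E \<in> converse ` P"
      then have "E\<inverse> \<in> P" by auto
      then show "\<exists>x. R (E\<inverse>) x
         \<and> tree_output (path_query E) (swap_queries T) = tree_output (path_query E) (cont x)
         \<and> num_queries (path_query E) (swap_queries T) \<le> k + num_queries (path_query E) (cont x)"
        using T out[of "E\<inverse>"] num[of "E\<inverse>"] ff by (metis converse_converse)
    qed
  qed
qed

lemma finds_query: "finds P 1 (\<lambda>E b. b \<longleftrightarrow> (u, v) \<in> E\<^sup>*)"
  unfolding finds_def
proof
  fix cont :: "bool \<Rightarrow> 'a query_tree"
  show "\<exists>T. \<forall>E\<in>P. \<exists>b. (b \<longleftrightarrow> (u, v) \<in> E\<^sup>*)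
     \<and> tree_output (path_query E) T = tree_output (path_query E) (cont b)
     \<and> num_queries (path_query E) T \<le> 1 + num_queries (path_query E) (cont b)"
    by (rule exI[of _ "Query u v cont"]) (simp add: path_query_def)
qed

lemma finds_scan:
  assumes "finite S"
  shows "finds P (card S) (\<lambda>E X. X = S \<inter> E\<^sup>*)"
  using assms
proof (induction S)
  case empty
  show ?case unfolding card.empty by (rule finds_return) simp
next
  case (insert p S)
  obtain u v where p: "p = (u, v)" by (cases p)
  have "finds P (card S + 1) (\<lambda>E X. X = insert p S \<inter> E\<^sup>*)"
  proof (rule finds_bind[OF insert.IH])
    fix X
    show "finds {E \<in> P. X = S \<inter> E\<^sup>*} 1 (\<lambda>E X. X = insert p S \<inter> E\<^sup>*)"
      by (rule finds_map[OF finds_query[of _ u v],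
            where f = "\<lambda>b. if b then insert p X else X"]) (auto simp: p)
  qed
  then show ?case
    using insert.hyps by simp
qed

text \<open>One pass suffices: once \<open>w\<close> has been compared with the current vertex, no later
  current vertex can lie strictly above \<open>w\<close>.\<close>

lemma finds_minimal:
  assumes "finite W" and "\<And>E. E \<in> P \<Longrightarrow> antisym (E\<^sup>*)"
  shows "finds P (card W) (\<lambda>E x. x \<in> insert v W \<and> (x, v) \<in> E\<^sup>*
    \<and> (\<forall>w\<in>W. (w, x) \<in> E\<^sup>* \<longrightarrow> w = x))"
  using assms(1)
proof (induction W)
  case empty
  show ?case unfolding card.empty by (rule finds_return[where x = v]) simp
next
  case (insert a W)
  have "finds P (card W + 1) (\<lambda>E x. x \<in> insert v (insert a W) \<and> (x, v) \<in> E\<^sup>*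
    \<and> (\<forall>w\<in>insert a W. (w, x) \<in> E\<^sup>* \<longrightarrow> w = x))"
  proof (rule finds_bind[OF insert.IH])
    fix x
    show "finds {E \<in> P. x \<in> insert v W \<and> (x, v) \<in> E\<^sup>* \<and> (\<forall>w\<in>W. (w, x) \<in> E\<^sup>* \<longrightarrow> w = x)} 1
      (\<lambda>E x. x \<in> insert v (insert a W) \<and> (x, v) \<in> E\<^sup>*
         \<and> (\<forall>w\<in>insert a W. (w, x) \<in> E\<^sup>* \<longrightarrow> w = x))"
    proof (rule finds_map[OF finds_query[of _ a x], where f = "\<lambda>b. if b then a else x"])
      fix E b
      assume E: "E \<in> {E \<in> P. x \<in> insert v W \<and> (x, v) \<in> E\<^sup>* \<and> (\<forall>w\<in>W. (w, x) \<in> E\<^sup>* \<longrightarrow> w = x)}"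
        and b: "b \<longleftrightarrow> (a, x) \<in> E\<^sup>*"
      have "w = a" if "(a, x) \<in> E\<^sup>*" "w \<in> W" "(w, a) \<in> E\<^sup>*" for w
        using E that assms(2)[of E] rtrancl_trans[of w a E x] by (auto dest: antisymD)
      then show "(if b then a else x) \<in> insert v (insert a W) \<and> ((if b then a else x), v) \<in> E\<^sup>*
         \<and> (\<forall>w\<in>insert a W. (w, if b then a else x) \<in> E\<^sup>* \<longrightarrow> w = (if b then a else x))"
        using E b rtrancl_trans[of a x E v] by auto
    qed
  qed
  then show ?case
    using insert.hyps by simp
qed

text \<open>Duality principle: with \<open>coords_converse\<close>, a search for sources or lower
  butterflies becomes one for targets or upper butterflies at the same cost.\<close>

lemma finds_dual:
  assumes "finds (converse ` P) k R" and "\<And>E x. E \<in> P \<Longrightarrow> R (E\<inverse>) x \<Longrightarrow> Q E x"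
  shows "finds P k Q"
proof -
  have "finds P k (\<lambda>E. R (E\<inverse>))"
    using finds_converse[OF assms(1)] by (simp add: image_image)
  then show ?thesis
    by (rule finds_map[where f = "\<lambda>x. x"]) (rule assms(2))
qed

lemma finds_scan_le:
  assumes "finite S" "card S \<le> k"
  shows "finds P k (\<lambda>E X. X = S \<inter> E\<^sup>*)"
  using finds_mono[OF finds_scan[OF assms(1)] assms(2)] .

section \<open>Coordinates\<close>

text \<open>The coordinates of a vertex are its level and \<open>h\<close> bits; an edge from level \<open>l\<close> to level \<open>l + 1\<close>
  may change only bit \<open>l\<close>. In the recursive construction, bit \<open>k\<close> tells the two copies of \<open>F\<^sup>k\<close>
  inside \<open>F\<^sup>k\<^sup>+\<^sup>1\<close> apart, and the \<open>a\<close>-th target has the binary digits of \<open>a\<close> as its bits.\<close>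

locale butterfly_coords =
  fixes h :: nat and V :: "'v set" and E :: "('v \<times> 'v) set"
    and lev :: "'v \<Rightarrow> nat" and bits :: "'v \<Rightarrow> nat \<Rightarrow> bool"
  assumes finite_V: "finite V"
    and lev_le: "v \<in> V \<Longrightarrow> lev v \<le> h"
    and ex_vertex: "l \<le> h \<Longrightarrow> \<exists>v\<in>V. lev v = l \<and> (\<forall>i<h. bits v i = f i)"
    and vertex_eqI: "u \<in> V \<Longrightarrow> v \<in> V \<Longrightarrow> lev u = lev v \<Longrightarrow>
      (\<And>i. i < h \<Longrightarrow> bits u i = bits v i) \<Longrightarrow> u = v"
    and edge_iff: "(u, v) \<in> E \<longleftrightarrow> u \<in> V \<and> v \<in> V \<and> lev v = Suc (lev u) \<and>
      (\<forall>i<h. i \<noteq> lev u \<longrightarrow> bits u i = bits v i)"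
begin

lemma reachD:
  assumes "(u, v) \<in> E\<^sup>*" and "u \<in> V"
  shows "v \<in> V \<and> lev u \<le> lev v \<and> (\<forall>i<h. i < lev u \<or> lev v \<le> i \<longrightarrow> bits u i = bits v i)"
  using assms
proof (induction rule: rtrancl_induct)
  case (step v w)
  then show ?case by (auto simp: edge_iff)
qed simp

text \<open>Climb one level at a time; the edge leaving level \<open>l\<close> may change bit
  \<open>l\<close>, so it sets this bit to that of \<open>v\<close>.\<close>

lemma reachI:
  assumes "u \<in> V" "v \<in> V" "lev u \<le> lev v"
    and "\<And>i. i < h \<Longrightarrow> i < lev u \<or> lev v \<le> i \<Longrightarrow> bits u i = bits v i"
  shows "(u, v) \<in> E\<^sup>*"
  using assms
proof (induction "lev v - lev u" arbitrary: u)
  case 0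
  have "u = v"
  proof (rule vertex_eqI)
    fix i assume "i < h"
    then show "bits u i = bits v i" using 0 by (cases "i < lev u") auto
  qed (use 0 in auto)
  then show ?case by simp
next
  case (Suc d)
  have "Suc (lev u) \<le> h" using Suc.hyps(2) lev_le[OF Suc.prems(2)] by simp
  then obtain w where w: "w \<in> V" "lev w = Suc (lev u)"
      "\<forall>i<h. bits w i = (if i = lev u then bits v i else bits u i)"
    using ex_vertex[of "Suc (lev u)" "\<lambda>i. if i = lev u then bits v i else bits u i"] by blast
  have "(u, w) \<in> E" using Suc.prems w by (auto simp: edge_iff)
  moreover have "(w, v) \<in> E\<^sup>*"
    by (rule Suc.hyps) (use Suc.hyps(2) Suc.prems w in auto)
  ultimately show ?case by (rule converse_rtrancl_into_rtrancl)
qed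

lemma reach_iff:
  assumes "u \<in> V" "v \<in> V"
  shows "(u, v) \<in> E\<^sup>* \<longleftrightarrow>
    lev u \<le> lev v \<and> (\<forall>i<h. i < lev u \<or> lev v \<le> i \<longrightarrow> bits u i = bits v i)"
  using reachD reachI assms by blast

lemma antisym_reach: "antisym (E\<^sup>*)"
proof (rule antisymI)
  fix u v assume uv: "(u, v) \<in> E\<^sup>*" "(v, u) \<in> E\<^sup>*"
  show "u = v"
  proof (cases "u \<in> V")
    case True
    with uv reachD[of u v] reachD[of v u] show ?thesis
      by (intro vertex_eqI) (auto simp: not_le)
  next
    case False
    have "\<And>w. (u, w) \<notin> E" using False by (simp add: edge_iff)
    then show ?thesis using uv(1) by (metis converse_rtranclE)
  qed
qed

lemma edge_iff_reach: "(u, v) \<in> E \<longleftrightarrow> u \<in> V \<and> v \<in> V \<and> (u, v) \<in> E\<^sup>* \<and> lev v = Suc (lev u)"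
proof -
  have "i \<noteq> l \<longleftrightarrow> i < l \<or> Suc l \<le> i" for i l :: nat by auto
  then show ?thesis by (auto simp: edge_iff reach_iff)
qed

text \<open>Reversal turns an edge from level \<open>l\<close> to \<open>l + 1\<close> into one from
  level \<open>h - 1 - l\<close> to \<open>h - l\<close>, so the free bit \<open>l\<close> has to
  become bit \<open>h - 1 - l\<close>.\<close>

lemma coords_converse: "butterfly_coords h V (E\<inverse>) (\<lambda>v. h - lev v) (\<lambda>v i. bits v (h - 1 - i))"
proof
  fix l f assume l: "l \<le> h"
  obtain v where v: "v \<in> V" "lev v = h - l" "\<forall>i<h. bits v i = f (h - 1 - i)"
    using ex_vertex[of "h - l" "\<lambda>i. f (h - 1 - i)"] by auto
  show "\<exists>v\<in>V. h - lev v = l \<and> (\<forall>i<h. bits v (h - 1 - i) = f i)"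
  proof (intro bexI conjI allI impI)
    show "h - lev v = l" using v l by simp
    fix i assume "i < h"
    then show "bits v (h - 1 - i) = f i" using v(3)[rule_format, of "h - 1 - i"] by simp
  qed (rule v)
next
  fix u v assume uv: "u \<in> V" "v \<in> V" "h - lev u = h - lev v"
    "\<And>i. i < h \<Longrightarrow> bits u (h - 1 - i) = bits v (h - 1 - i)"
  show "u = v"
  proof (rule vertex_eqI)
    show "lev u = lev v" using uv lev_le[of u] lev_le[of v] by simp
    fix i assume "i < h"
    then show "bits u i = bits v i" using uv(4)[of "h - 1 - i"] by simp
  qed (rule uv)+
next
  fix u v
  show "((u, v) \<in> E\<inverse>) = (u \<in> V \<and> v \<in> V \<and> h - lev v = Suc (h - lev u) \<and>
      (\<forall>i<h. i \<noteq> h - lev u \<longrightarrow> bits u (h - 1 - i) = bits v (h - 1 - i)))"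
  proof (cases "u \<in> V \<and> v \<in> V \<and> lev u = Suc (lev v)")
    case True
    then have "lev u \<le> h" using lev_le by blast
    have "(\<forall>i<h. i \<noteq> lev v \<longrightarrow> bits v i = bits u i) \<longleftrightarrow>
       (\<forall>i<h. i \<noteq> h - lev u \<longrightarrow> bits u (h - 1 - i) = bits v (h - 1 - i))" (is "?A \<longleftrightarrow> ?B")
    proof
      assume ?A
      show ?B
      proof (intro allI impI)
        fix i assume "i < h" "i \<noteq> h - lev u"
        then show "bits u (h - 1 - i) = bits v (h - 1 - i)"
          using \<open>?A\<close>[rule_format, of "h - 1 - i"] True by simp
      qed
    next
      assume ?B
      show ?A
      proof (intro allI impI)
        fix i assume "i < h" "i \<noteq> lev v"
        then show "bits v i = bits u i"
          using \<open>?B\<close>[rule_format, of "h - 1 - i"] True \<open>lev u \<le> h\<close> by simp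
      qed
    qed
    then show ?thesis
      using True \<open>lev u \<le> h\<close> by (simp add: edge_iff Suc_diff_Suc)
  next
    case False
    then show ?thesis using lev_le[of u] lev_le[of v] by (auto simp: edge_iff)
  qed
qed (auto simp: finite_V)

end

section \<open>Binary digits, and coordinates for the recursive construction\<close>

lemma ex_nat_bits: "\<exists>n<2 ^ k. \<forall>i<k. odd ((n :: nat) div 2 ^ i) = f i"
proof (induction k arbitrary: f)
  case (Suc k)
  obtain n :: nat where n: "n < 2 ^ k" "\<forall>i<k. odd (n div 2 ^ i) = f (Suc i)"
    using Suc.IH[of "\<lambda>i. f (Suc i)"] by blast
  let ?n = "of_bool (f 0) + 2 * n"
  have "odd (?n div 2 ^ i) = f i" if "i < Suc k" for i
  proof (cases i)
    case (Suc j)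
    have "?n div 2 ^ Suc j = ?n div 2 div 2 ^ j" by (simp only: power_Suc div_mult2_eq)
    also have "?n div 2 = n" by simp
    finally show ?thesis using n(2) that Suc by simp
  qed simp
  moreover have "?n < 2 ^ Suc k" using n(1) by (simp add: of_bool_def)
  ultimately show ?case by blast
qed simp

lemma nat_bits_inject:
  fixes a b :: nat
  assumes "a < 2 ^ k" "b < 2 ^ k" "\<And>i. i < k \<Longrightarrow> odd (a div 2 ^ i) = odd (b div 2 ^ i)"
  shows "a = b"
proof -
  have "take_bit k a = take_bit k b"
    using assms(3)[folded bit_iff_odd] by (intro bit_eqI) (auto simp: bit_take_bit_iff)
  then show ?thesis
    using assms(1,2) by (simp add: take_bit_eq_mod)
qed

lemma odd_div_mod_pow2:
  fixes a :: nat
  assumes "i < k"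
  shows "odd (a mod 2 ^ k div 2 ^ i) = odd (a div 2 ^ i)"
  using assms by (simp add: bit_take_bit_iff flip: take_bit_eq_mod bit_iff_odd)

text \<open>The recursion glues the copies along target indices, so the induction must also carry
  the relation between the index of a target and its bits.\<close>

lemma butterfly_coords_exist:
  assumes "butterfly k V E ts"
  shows "\<exists>lev bits. butterfly_coords k V E lev bits \<and>
    (\<forall>a<2 ^ k. lev (ts ! a) = k \<and> (\<forall>i<k. bits (ts ! a) i = odd (a div 2 ^ i)))"
  using assms
proof (induction rule: butterfly.induct)
  case (base v)
  show ?case
    by (intro exI[of _ "\<lambda>_. 0"] exI[of _ "\<lambda>_ _. False"])
      (simp add: butterfly_coords_def)
next
  case (step k VA EA ta VB EB tb m t v)
  obtain levA bitsA where A: "butterfly_coords k VA EA levA bitsA"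
    and tA: "\<forall>a<2 ^ k. levA (ta ! a) = k \<and> (\<forall>i<k. bitsA (ta ! a) i = odd (a div 2 ^ i))"
    using step.IH(1) by blast
  obtain levB bitsB where B: "butterfly_coords k VB EB levB bitsB"
    and tB: "\<forall>a<2 ^ k. levB (tb ! a) = k \<and> (\<forall>i<k. bitsB (tb ! a) i = odd (a div 2 ^ i))"
    using step.IH(2) by blast
  interpret A: butterfly_coords k VA EA levA bitsA by (rule A)
  interpret B: butterfly_coords k VB EB levB bitsB by (rule B)
  note lens = butterfly_length[OF step.hyps(1)] butterfly_length[OF step.hyps(2)]
  have nA: "ta ! a \<in> VA" if "a < m" for a
    using butterfly_targets[OF step.hyps(1)] lens that step.hyps by auto
  have nB: "tb ! a \<in> VB" if "a < m" for a
    using butterfly_targets[OF step.hyps(2)] lens that step.hyps by auto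
  define ix where "ix w = (SOME a. a < 2 * m \<and> v ! a = w)" for w
  have ix: "ix (v ! a) = a" if "a < 2 * m" for a
    unfolding ix_def using that step.hyps(6,7)
    by (intro some_equality) (auto simp: nth_eq_iff_index_eq)
  have v_nth: "v ! a \<in> set v" if "a < 2 * m" for a using that step.hyps(6) by simp
  have ex_ix: "\<exists>a<2 * m. w = v ! a" if "w \<in> set v" for w
    using that step.hyps(6) by (metis in_set_conv_nth)
  define lev where "lev w = (if w \<in> VA then levA w else if w \<in> VB then levB w else Suc k)" for w
  define bits where "bits w i = (if w \<in> VA then i < k \<and> bitsA w i
    else if w \<in> VB then i = k \<or> bitsB w i else odd (ix w div 2 ^ i))" for w i
  have disj: "VA \<inter> VB = {}" "VA \<inter> set v = {}" "VB \<inter> set v = {}" using step.hyps by auto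
  have A_simps: "w \<notin> VB" "w \<notin> set v" "lev w = levA w" "\<not> bits w k"
    "i < k \<Longrightarrow> bits w i = bitsA w i" if "w \<in> VA" for w i
    using that disj by (auto simp: lev_def bits_def)
  have B_simps: "w \<notin> VA" "w \<notin> set v" "lev w = levB w" "bits w k"
    "i < k \<Longrightarrow> bits w i = bitsB w i" if "w \<in> VB" for w i
    using that disj by (auto simp: lev_def bits_def)
  have v_simps: "v ! a \<notin> VA" "v ! a \<notin> VB" "lev (v ! a) = Suc k"
    "bits (v ! a) i = odd (a div 2 ^ i)" if "a < 2 * m" for a i
    using v_nth[OF that] ix[OF that] disj by (auto simp: lev_def bits_def)
  have bit_k: "odd (a div 2 ^ k) \<longleftrightarrow> m \<le> a" if "a < 2 * m" for a
  proof (cases "m \<le> a")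
    case True
    then obtain b where "a = m + b" by (metis le_Suc_ex)
    then show ?thesis using step.hyps(4) \<open>a < 2 * m\<close> by simp
  qed (use step.hyps(4) in simp)
  have t_nth: "t ! a \<in> (if a < m then VA else VB)" "lev (t ! a) = k"
    "i < Suc k \<Longrightarrow> bits (t ! a) i = odd (a div 2 ^ i)" if a: "a < 2 * m" for a i
  proof -
    consider "a < m" "t ! a = ta ! a" | b where "a = m + b" "b < m" "t ! a = tb ! b"
    proof (cases "a < m")
      case True
      then show thesis
        using that(1) step.hyps(4,5) lens by (simp add: nth_append)
    next
      case False
      then have "a = m + (a - m)" "a - m < m" using a by auto
      moreover have "t ! a = tb ! (a - m)"
        using False step.hyps(4,5) lens by (simp add: nth_append)
      ultimately show thesis using that(2) by blast
    qed
    then have "t ! a \<in> (if a < m then VA else VB) \<and> lev (t ! a) = k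
      \<and> (i < Suc k \<longrightarrow> bits (t ! a) i = odd (a div 2 ^ i))"
    proof cases
      case 1
      then show ?thesis
        using nA[of a] A_simps[OF nA[of a]] tA step.hyps(4) by (auto simp: less_Suc_eq)
    next
      case 2
      have "odd ((m + b) div 2 ^ i) = odd (b div 2 ^ i)" if "i < k"
        using odd_div_mod_pow2[OF that, of "m + b"] odd_div_mod_pow2[OF that, of b] step.hyps(4)
        by simp
      moreover have "odd ((m + b) div 2 ^ k)" using 2 step.hyps(4) by simp
      ultimately show ?thesis
        using 2 nB[of b] B_simps[OF nB[of b]] tB step.hyps(4) by (auto simp: less_Suc_eq)
    qed
    then show "t ! a \<in> (if a < m then VA else VB)" "lev (t ! a) = k"
      "i < Suc k \<Longrightarrow> bits (t ! a) i = odd (a div 2 ^ i)" by blast+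
  qed
  let ?V = "VA \<union> VB \<union> set v"
  let ?N = "\<Union>i\<in>{0..<m}. {(t ! i, v ! i), (t ! i, v ! (i + m)),
                                   (t ! (i + m), v ! i), (t ! (i + m), v ! (i + m))}"
  \<comment> \<open>The new edges join indices congruent modulo \<open>m = 2 ^ k\<close>, that is,
    indices whose digits below \<open>k\<close> agree; digit \<open>k\<close> is the one free bit at
    level \<open>k\<close>.\<close>
  have N_iff: "(u, w) \<in> ?N \<longleftrightarrow> (\<exists>a<2 * m. \<exists>b<2 * m. u = t ! a \<and> w = v ! b \<and> a mod m = b mod m)"
    (is "_ \<longleftrightarrow> ?R") for u w
  proof
    assume "(u, w) \<in> ?N"
    then obtain i where "i < m" and i: "(u, w) \<in> {(t ! i, v ! i), (t ! i, v ! (i + m)),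
                                   (t ! (i + m), v ! i), (t ! (i + m), v ! (i + m))}"
      by auto
    from i \<open>i < m\<close> show ?R
      apply (elim insertE emptyE)
      subgoal by (intro exI[of _ i] conjI) auto
      subgoal by (rule exI[of _ i], simp, rule exI[of _ "i + m"], simp)
      subgoal by (rule exI[of _ "i + m"], simp, rule exI[of _ i], simp)
      subgoal by (rule exI[of _ "i + m"], simp, rule exI[of _ "i + m"], simp)
      done
  next
    assume ?R
    then obtain a b where ab: "a < 2 * m" "b < 2 * m" "u = t ! a" "w = v ! b" "a mod m = b mod m"
      by blast
    have split: "c = c mod m \<or> c = c mod m + m" if "c < 2 * m" for c
      using that by (cases "c < m") (auto simp: le_mod_geq not_less)
    have "a mod m < m" using step.hyps(4) by simp
    then show "(u, w) \<in> ?N"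
      using split[OF ab(1)] split[OF ab(2)] ab(3-5)
      by (intro UN_I[of "a mod m"]) auto
  qed
  have coords: "butterfly_coords (Suc k) ?V (EA \<union> EB \<union> ?N) lev bits"
  proof
    show "finite ?V" using A.finite_V B.finite_V by simp
    show "lev w \<le> Suc k" if "w \<in> ?V" for w
      using A.lev_le[of w] B.lev_le[of w] by (auto simp: lev_def)
  next
    fix l f assume l: "l \<le> Suc k"
    show "\<exists>w\<in>?V. lev w = l \<and> (\<forall>i<Suc k. bits w i = f i)"
    proof (cases "l = Suc k")
      case True
      obtain a :: nat where "a < 2 ^ Suc k" "\<forall>i<Suc k. odd (a div 2 ^ i) = f i"
        using ex_nat_bits[of "Suc k" f] by blast
      then show ?thesis
        using True v_nth[of a] v_simps[of a] step.hyps(4) by (intro bexI[of _ "v ! a"]) auto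
    next
      case False
      then have "l \<le> k" using l by simp
      show ?thesis
      proof (cases "f k")
        case True
        obtain w where "w \<in> VB" "levB w = l" "\<forall>i<k. bitsB w i = f i"
          using B.ex_vertex[OF \<open>l \<le> k\<close>, of f] by blast
        then show ?thesis
          using True B_simps[of w] by (intro bexI[of _ w]) (auto simp: less_Suc_eq)
      next
        case False
        obtain w where "w \<in> VA" "levA w = l" "\<forall>i<k. bitsA w i = f i"
          using A.ex_vertex[OF \<open>l \<le> k\<close>, of f] by blast
        then show ?thesis
          using False A_simps[of w] by (intro bexI[of _ w]) (auto simp: less_Suc_eq)
      qed
    qed
  next
    fix u w assume uw: "u \<in> ?V" "w \<in> ?V" "lev u = lev w" "\<And>i. i < Suc k \<Longrightarrow> bits u i = bits w i"
    \<comment> \<open>The level separates the new vertices from the two copies, and bit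
      \<open>k\<close> separates the copies; so equal coordinates place both vertices in the same
      part.\<close>
    have new: "x \<in> set v \<longleftrightarrow> lev x = Suc k" if "x \<in> ?V" for x
    proof
      assume "x \<in> set v"
      then show "lev x = Suc k" using ex_ix v_simps(3) by metis
    next
      assume "lev x = Suc k"
      then have "x \<notin> VA" "x \<notin> VB"
        using A_simps(3)[of x] B_simps(3)[of x] A.lev_le[of x] B.lev_le[of x] by force+
      then show "x \<in> set v" using that by blast
    qed
    show "u = w"
    proof (cases "u \<in> set v")
      case True
      then have "w \<in> set v" using new uw by metis
      then obtain a b where ab: "a < 2 * m" "u = v ! a" "b < 2 * m" "w = v ! b"
        using True ex_ix by blast
      have "a = b"
        by (rule nat_bits_inject[of _ "Suc k"]) (use ab v_simps uw(4) step.hyps(4) in auto)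
      then show ?thesis using ab by simp
    next
      case False
      then have "w \<notin> set v" using new uw by metis
      have eqA: "u = w" if "u \<in> VA" "w \<in> VA"
        using that uw(3,4) A_simps(3,5)[OF that(1)] A_simps(3,5)[OF that(2)]
        by (intro A.vertex_eqI) auto
      have eqB: "u = w" if "u \<in> VB" "w \<in> VB"
        using that uw(3,4) B_simps(3,5)[OF that(1)] B_simps(3,5)[OF that(2)]
        by (intro B.vertex_eqI) auto
      have bits_k: "bits x k \<longleftrightarrow> x \<in> VB" if "x \<in> VA \<union> VB" for x
        using that A_simps(1,4)[of x] B_simps(4)[of x] by blast
      show ?thesis
        using bits_k[of u] bits_k[of w] False \<open>w \<notin> set v\<close> uw(1,2) uw(4)[of k] eqA eqB by blast
    qed
  next
    fix u w
    show "(u, w) \<in> EA \<union> EB \<union> ?N \<longleftrightarrow> u \<in> ?V \<and> w \<in> ?V \<and> lev w = Suc (lev u) \<and>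
      (\<forall>i<Suc k. i \<noteq> lev u \<longrightarrow> bits u i = bits w i)" (is "_ \<longleftrightarrow> ?R")
    proof
      assume "(u, w) \<in> EA \<union> EB \<union> ?N"
      then consider "(u, w) \<in> EA" | "(u, w) \<in> EB" | "(u, w) \<in> ?N" by blast
      then show ?R
      proof cases
        case 1
        then show ?thesis
          using A_simps[of u] A_simps[of w] by (auto simp: A.edge_iff less_Suc_eq)
      next
        case 2
        then show ?thesis
          using B_simps[of u] B_simps[of w] by (auto simp: B.edge_iff less_Suc_eq)
      next
        case 3
        then obtain a b where ab: "a < 2 * m" "b < 2 * m" "u = t ! a" "w = v ! b" "a mod m = b mod m"
          using N_iff by blast
        have "odd (a div 2 ^ i) = odd (b div 2 ^ i)" if "i < k" for i
          using odd_div_mod_pow2[OF that] ab(5) step.hyps(4) by metis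
        then show ?thesis
          using ab t_nth[of a] v_simps[of b] v_nth[of b] by (auto split: if_splits simp: less_Suc_eq)
      qed
    next
      assume R: ?R
      consider "u \<in> VA" "w \<in> VA" | "u \<in> VB" "w \<in> VB" | "u \<in> VA" "w \<in> VB" | "u \<in> VB" "w \<in> VA"
        | "u \<in> set v" | "u \<in> VA \<union> VB" "w \<in> set v" using R by blast
      then show "(u, w) \<in> EA \<union> EB \<union> ?N"
      proof cases
        case 1
        then have "(u, w) \<in> EA"
          using R A_simps[of u] A_simps[of w] by (auto simp: A.edge_iff less_Suc_eq)
        then show ?thesis by blast
      next
        case 2
        then have "(u, w) \<in> EB"
          using R B_simps[of u] B_simps[of w] by (auto simp: B.edge_iff less_Suc_eq)
        then show ?thesis by blast
      next
        \<comment> \<open>Bit \<open>k\<close> differs between the copies, so such an edge would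
          start at level \<open>k\<close> and end at level \<open>Suc k\<close>, a level absent from
          both copies.\<close>
        case 3
        then have "lev u = k" using R A_simps[of u] B_simps[of w] by (metis lessI)
        then show ?thesis using 3 R B.lev_le[of w] B_simps(3)[of w] by simp
      next
        case 4
        then have "lev u = k" using R B_simps[of u] A_simps[of w] by (metis lessI)
        then show ?thesis using 4 R A.lev_le[of w] A_simps(3)[of w] by simp
      next
        case 5
        then obtain a where "a < 2 * m" "u = v ! a" using ex_ix by blast
        then have "lev u = Suc k" using v_simps(3) by simp
        moreover have "lev w \<le> Suc k"
          using A.lev_le[of w] B.lev_le[of w] by (auto simp: lev_def)
        ultimately show ?thesis using R by simp
      next
        case 6
        then obtain b where b: "b < 2 * m" "w = v ! b" using ex_ix by blast
        then have lev_u: "lev u = k" using R v_simps(3)[of b] by simp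
        \<comment> \<open>The index \<open>u\<close> must have as a target: its lower digits come
          from \<open>b\<close>, and its digit \<open>k\<close> from the copy containing
          \<open>u\<close>.\<close>
        define c where "c = (if u \<in> VA then b mod m else b mod m + m)"
        have bm: "b mod m < m" using step.hyps(4) by simp
        then have c: "c < 2 * m" "c mod m = b mod m" "c < m \<longleftrightarrow> u \<in> VA" by (auto simp: c_def)
        have tc: "bits (t ! c) i = bits u i" if "i < k" for i
        proof -
          have "bits (t ! c) i = odd (c div 2 ^ i)" using t_nth(3)[OF c(1)] that by simp
          also have "\<dots> = odd (b div 2 ^ i)"
            using odd_div_mod_pow2[OF that] c(2) step.hyps(4) by metis
          also have "\<dots> = bits w i" using v_simps(4) b by simp
          also have "\<dots> = bits u i" using R lev_u that by auto
          finally show ?thesis .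
        qed
        have "u = t ! c"
        proof (cases "u \<in> VA")
          case True
          then have "t ! c \<in> VA" using t_nth(1)[OF c(1)] c(3) by simp
          with True show ?thesis
            using tc lev_u t_nth(2)[OF c(1)] A_simps(3,5)[of u] A_simps(3,5)[of "t ! c"]
            by (intro A.vertex_eqI) auto
        next
          case False
          then have "u \<in> VB" "t ! c \<in> VB" using 6 t_nth(1)[OF c(1)] c(3) by auto
          then show ?thesis
            using tc lev_u t_nth(2)[OF c(1)] B_simps(3,5)[of u] B_simps(3,5)[of "t ! c"]
            by (intro B.vertex_eqI) auto
        qed
        then have "(u, w) \<in> ?N" using N_iff b c by blast
        then show ?thesis by blast
      qed
    qed
  qed
  show ?case
    using coords v_simps step.hyps(4) by (intro exI[of _ lev] exI[of _ bits]) auto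
qed

section \<open>Sources, targets and the middle level\<close>

text \<open>This lemma and the next translate the index ranges that arise when
  \<open>coords_converse\<close> reverses the order of the bits.\<close>

lemma all_rev_ge_iff:
  assumes "(m :: nat) \<le> h"
  shows "(\<forall>i<h. h - m \<le> i \<longrightarrow> Q (h - 1 - i)) \<longleftrightarrow> (\<forall>i<m. Q i)"
proof
  assume L: "\<forall>i<h. h - m \<le> i \<longrightarrow> Q (h - 1 - i)"
  show "\<forall>i<m. Q i"
  proof (intro allI impI)
    fix i assume "i < m"
    then show "Q i" using L[rule_format, of "h - 1 - i"] assms by simp
  qed
qed (use assms in auto)

lemma all_rev_less_iff:
  assumes "(m :: nat) \<le> h"
  shows "(\<forall>i<h - m. Q (h - 1 - i)) \<longleftrightarrow> (\<forall>i<h. m \<le> i \<longrightarrow> Q i)"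
proof
  assume L: "\<forall>i<h - m. Q (h - 1 - i)"
  show "\<forall>i<h. m \<le> i \<longrightarrow> Q i"
  proof (intro allI impI)
    fix i assume "i < h" "m \<le> i"
    then show "Q i" using L[rule_format, of "h - 1 - i"] by simp
  qed
qed (use assms in auto)

context butterfly_coords
begin

text \<open>A level-\<open>m\<close> vertex below \<open>t\<close> shares the bits of
  \<open>t\<close> below \<open>m\<close>, which leaves only the \<open>h - m\<close> others
  free.\<close>

lemma card_cone_le:
  assumes "m \<le> h" "t \<in> V" "lev t = h"
  shows "card {w \<in> V. lev w = m \<and> (w, t) \<in> E\<^sup>*} \<le> 2 ^ (h - m)"
proof -
  let ?W = "{w \<in> V. lev w = m \<and> (w, t) \<in> E\<^sup>*}"
  have "inj_on (\<lambda>w. {i \<in> {m..<h}. bits w i}) ?W"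
  proof (rule inj_onI)
    fix w w' assume w: "w \<in> ?W" "w' \<in> ?W" "{i \<in> {m..<h}. bits w i} = {i \<in> {m..<h}. bits w' i}"
    show "w = w'"
    proof (rule vertex_eqI)
      fix i assume "i < h"
      show "bits w i = bits w' i"
      proof (cases "i < m")
        case True
        then have "bits x i = bits t i" if "x \<in> ?W" for x
          using that reach_iff[of x t] assms(2) \<open>i < h\<close> by blast
        then show ?thesis using w(1,2) by blast
      next
        case False
        then have "i \<in> {i \<in> {m..<h}. bits w i} \<longleftrightarrow> bits w i" "i \<in> {i \<in> {m..<h}. bits w' i} \<longleftrightarrow> bits w' i"
          using \<open>i < h\<close> by auto
        then show ?thesis using w(3) by metis
      qed
    qed (use w in auto)
  qed
  then have "card ?W \<le> card (Pow {m..<h})"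
    by (rule card_inj_on_le) auto
  then show ?thesis by (simp add: card_Pow)
qed

text \<open>The path from a source to a target is unique: its vertex on level \<open>l\<close> has
  already taken the bits of \<open>t\<close> below \<open>l\<close> and keeps those of
  \<open>s\<close> from \<open>l\<close> on.\<close>

lemma path_iff:
  assumes "s \<in> V" "t \<in> V" "lev s = 0" "lev t = h" "w \<in> V"
  shows "(s, w) \<in> E\<^sup>* \<and> (w, t) \<in> E\<^sup>* \<longleftrightarrow>
    (\<forall>i<h. bits w i = (if i < lev w then bits t i else bits s i))"
  using assms lev_le[of w] by (auto simp: reach_iff not_less)

text \<open>The path is a chain with one vertex per level. Hence levels, which cannot be queried,
  can be read off by counting path vertices below \<open>w\<close>.\<close>

lemma path_levels:
  assumes "s \<in> V" "t \<in> V" "lev s = 0" "lev t = h"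
  defines "X \<equiv> {w \<in> V. (s, w) \<in> E\<^sup>* \<and> (w, t) \<in> E\<^sup>*}"
  shows "bij_betw lev X {..h}"
    and "w \<in> X \<Longrightarrow> card {x \<in> X. (x, w) \<in> E\<^sup>*} = Suc (lev w)"
proof -
  have X: "w \<in> X \<longleftrightarrow> w \<in> V \<and> (\<forall>i<h. bits w i = (if i < lev w then bits t i else bits s i))" for w
    unfolding X_def using path_iff[OF assms(1-4)] by blast
  show bij: "bij_betw lev X {..h}"
  proof (rule bij_betw_imageI)
    show "inj_on lev X"
      by (rule inj_onI) (auto simp: X intro: vertex_eqI)
    show "lev ` X = {..h}"
    proof
      show "lev ` X \<subseteq> {..h}" using X lev_le by auto
      show "{..h} \<subseteq> lev ` X"
      proof
        fix l assume "l \<in> {..h}"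
        then obtain w where "w \<in> V" "lev w = l" "\<forall>i<h. bits w i = (if i < l then bits t i else bits s i)"
          using ex_vertex[of l "\<lambda>i. if i < l then bits t i else bits s i"] by blast
        then have "w \<in> X" by (simp add: X)
        then show "l \<in> lev ` X" using \<open>lev w = l\<close> by blast
      qed
    qed
  qed
  assume w: "w \<in> X"
  have le: "(x, w) \<in> E\<^sup>* \<longleftrightarrow> lev x \<le> lev w" if "x \<in> X" for x
    using that w lev_le[of w] by (auto simp: X reach_iff)
  have "lev ` {x \<in> X. (x, w) \<in> E\<^sup>*} = {..lev w}"
  proof
    show "lev ` {x \<in> X. (x, w) \<in> E\<^sup>*} \<subseteq> {..lev w}" using le by auto
    show "{..lev w} \<subseteq> lev ` {x \<in> X. (x, w) \<in> E\<^sup>*}"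
    proof
      fix l assume "l \<in> {..lev w}"
      then have "l \<in> lev ` X"
        using bij w lev_le[of w] by (auto simp: X bij_betw_def)
      then show "l \<in> lev ` {x \<in> X. (x, w) \<in> E\<^sup>*}"
        using le \<open>l \<in> {..lev w}\<close> by auto
    qed
  qed
  moreover have "inj_on lev {x \<in> X. (x, w) \<in> E\<^sup>*}"
    using bij by (auto simp: bij_betw_def inj_on_def)
  ultimately show "card {x \<in> X. (x, w) \<in> E\<^sup>*} = Suc (lev w)"
    using card_image[of lev "{x \<in> X. (x, w) \<in> E\<^sup>*}"] by simp
qed

text \<open>Both \<open>p\<close> and \<open>v\<close> lie below \<open>t\<close>, so they agree on
  all bits below the smaller of their levels. Only the bits from the larger level on can obstruct a
  path, and there \<open>p\<close> has the bits of \<open>s\<close>.\<close>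

lemma comparable_iff:
  assumes "s \<in> V" "t \<in> V" "lev s = 0" "lev t = h" "p \<in> V" "lev p = m"
    "(s, p) \<in> E\<^sup>*" "(p, t) \<in> E\<^sup>*" "v \<in> V" "(v, t) \<in> E\<^sup>*"
  shows "(p, v) \<in> E\<^sup>* \<or> (v, p) \<in> E\<^sup>* \<longleftrightarrow> (\<forall>i<h. max (lev v) m \<le> i \<longrightarrow> bits v i = bits s i)"
    (is "?L \<longleftrightarrow> ?R")
proof -
  have p: "bits p i = (if i < m then bits t i else bits s i)" if "i < h" for i
    using path_iff[OF assms(1-5)] assms that by blast
  have v: "bits v i = bits t i" if "i < lev v" "i < h" for i
    using assms that by (simp add: reach_iff)
  show ?thesis
  proof (cases "lev v \<le> m")
    case True
    show ?thesis
    proof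
      assume ?L
      then show ?R using True p assms by (auto simp: reach_iff)
    next
      assume ?R
      then have "(v, p) \<in> E\<^sup>*"
        using True p v assms by (intro reachI) (auto simp: max_def)
      then show ?L ..
    qed
  next
    case False
    show ?thesis
    proof
      assume ?L
      then show ?R using False p assms by (auto simp: reach_iff)
    next
      assume ?R
      then have "(p, v) \<in> E\<^sup>*"
        using False p v assms by (intro reachI) (auto simp: max_def)
      then show ?L ..
    qed
  qed
qed

lemma comparable_source:
  assumes "s \<in> V" "lev s = 0" "v \<in> V" "(s, v) \<in> E\<^sup>*" "i < h" "lev v \<le> i"
  shows "bits s i = bits v i"
  using assms by (simp add: reach_iff)

text \<open>Fewer than \<open>2 ^ (h - m)\<close> sources cannot realise every pattern of the bits
  from \<open>m\<close> on.\<close>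

lemma ex_missing_pattern:
  assumes "finite S" "card S < 2 ^ (h - m)"
  shows "\<exists>f. \<forall>s\<in>S. \<exists>i<h. m \<le> i \<and> bits s i \<noteq> f i"
proof -
  let ?g = "\<lambda>s. {i \<in> {m..<h}. bits s i}"
  have "card (?g ` S) < card (Pow {m..<h})"
    using card_image_le[OF assms(1), of ?g] assms(2) by (simp add: card_Pow)
  then have "\<not> Pow {m..<h} \<subseteq> ?g ` S"
    using card_mono[of "?g ` S" "Pow {m..<h}"] assms(1) by auto
  then obtain A where A: "A \<subseteq> {m..<h}" "A \<notin> ?g ` S" by blast
  have "\<exists>i<h. m \<le> i \<and> bits s i \<noteq> (i \<in> A)" if "s \<in> S" for s
  proof (rule ccontr)
    assume "\<not> ?thesis"
    then have "A = ?g s" using A(1) by auto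
    then show False using A(2) that by blast
  qed
  then show ?thesis by (intro exI[of _ "\<lambda>i. i \<in> A"]) blast
qed

section \<open>Transversals and the recognition of the middle level\<close>

text \<open>Only injectivity and the right cardinality are demanded, which is what a successive
  search delivers; that every class is met follows by counting in
  \<open>source_transversal_ex\<close>.\<close>

definition source_transversal :: "nat \<Rightarrow> 'v set \<Rightarrow> bool" where
  "source_transversal m S \<longleftrightarrow> S \<subseteq> V \<and> card S = 2 ^ (h - m) \<and> (\<forall>s\<in>S. lev s = 0) \<and>
    (\<forall>s\<in>S. \<forall>s'\<in>S. (\<forall>i<h. m \<le> i \<longrightarrow> bits s i = bits s' i) \<longrightarrow> s = s')"

definition target_transversal :: "nat \<Rightarrow> 'v set \<Rightarrow> bool" where
  "target_transversal m T \<longleftrightarrow> T \<subseteq> V \<and> card T = 2 ^ m \<and> (\<forall>t\<in>T. lev t = h) \<and>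
    (\<forall>t\<in>T. \<forall>t'\<in>T. (\<forall>i<m. bits t i = bits t' i) \<longrightarrow> t = t')"

lemma source_transversal_ex:
  assumes "source_transversal m S"
  shows "\<exists>s\<in>S. \<forall>i<h. m \<le> i \<longrightarrow> bits s i = f i"
proof -
  note S = assms[unfolded source_transversal_def]
  let ?g = "\<lambda>s. {i \<in> {m..<h}. bits s i}"
  have mem: "i \<in> ?g s \<longleftrightarrow> bits s i" if "i < h" "m \<le> i" for i s using that by simp
  have "inj_on ?g S"
  proof (rule inj_onI)
    fix s s' assume s: "s \<in> S" "s' \<in> S" "?g s = ?g s'"
    then have "\<forall>i<h. m \<le> i \<longrightarrow> bits s i = bits s' i" using mem by metis
    then show "s = s'" using S s by blast
  qed
  then have "card (?g ` S) = card (Pow {m..<h})"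
    using S by (simp add: card_image card_Pow)
  then have "?g ` S = Pow {m..<h}"
    by (intro card_subset_eq) auto
  moreover have "{i \<in> {m..<h}. f i} \<in> Pow {m..<h}" by blast
  ultimately obtain s where "s \<in> S" "{i \<in> {m..<h}. f i} = ?g s" by (metis (no_types, lifting) imageE)
  then show ?thesis by (intro bexI[of _ s]) auto
qed

lemma transversal_converse:
  assumes "m \<le> h"
  shows "butterfly_coords.source_transversal h V (\<lambda>v. h - lev v) (\<lambda>v i. bits v (h - 1 - i)) (h - m) T
    \<longleftrightarrow> target_transversal m T"
    and "butterfly_coords.target_transversal h V (\<lambda>v. h - lev v) (\<lambda>v i. bits v (h - 1 - i)) (h - m) T
    \<longleftrightarrow> source_transversal m T"
proof -
  interpret D: butterfly_coords h V "E\<inverse>" "\<lambda>v. h - lev v" "\<lambda>v i. bits v (h - 1 - i)"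
    by (rule coords_converse)
  have lev: "h - lev t = 0 \<longleftrightarrow> lev t = h" "h - lev t = h \<longleftrightarrow> lev t = 0" if "T \<subseteq> V" "t \<in> T" for t
    using that lev_le[of t] by auto
  show "D.source_transversal (h - m) T \<longleftrightarrow> target_transversal m T"
    unfolding D.source_transversal_def target_transversal_def
      all_rev_ge_iff[OF assms, of "\<lambda>i. bits _ i = bits _ i"] using lev assms by auto
  show "D.target_transversal (h - m) T \<longleftrightarrow> source_transversal m T"
    unfolding D.target_transversal_def source_transversal_def
      all_rev_less_iff[OF assms, of "\<lambda>i. bits _ i = bits _ i"] using lev assms by auto
qed

lemma target_transversal_ex:
  assumes "m \<le> h" "target_transversal m T"
  shows "\<exists>t\<in>T. \<forall>i<m. bits t i = f i"
proof -
  interpret D: butterfly_coords h V "E\<inverse>" "\<lambda>v. h - lev v" "\<lambda>v i. bits v (h - 1 - i)"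
    by (rule coords_converse)
  obtain t where t: "t \<in> T" "\<forall>i<h. h - m \<le> i \<longrightarrow> bits t (h - 1 - i) = f (h - 1 - i)"
    using D.source_transversal_ex[of "h - m" T "\<lambda>i. f (h - 1 - i)"]
      transversal_converse(1)[OF assms(1)] assms(2) by blast
  have "bits t i = f i" if "i < m" for i
    using t(2)[rule_format, of "h - 1 - i"] that assms(1) by simp
  then show ?thesis using t(1) by blast
qed

text \<open>On level \<open>m\<close> each class contributes exactly one source and one target.
  Above it, bit \<open>lev w - 1\<close> is free for the sources below \<open>w\<close>, so there
  are two; below it, bit \<open>lev w\<close> is free for the targets above
  \<open>w\<close>.\<close>

lemma middle_level_iff:
  assumes m: "m \<le> h" and S: "source_transversal m S" and T: "target_transversal m T" and w: "w \<in> V"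
  shows "lev w = m \<longleftrightarrow> (\<exists>!s. s \<in> S \<and> (s, w) \<in> E\<^sup>*) \<and> (\<exists>!t. t \<in> T \<and> (w, t) \<in> E\<^sup>*)"
proof -
  note SD = S[unfolded source_transversal_def]
  note TD = T[unfolded target_transversal_def]
  have s_iff: "(s, w) \<in> E\<^sup>* \<longleftrightarrow> (\<forall>i<h. lev w \<le> i \<longrightarrow> bits s i = bits w i)" if "s \<in> S" for s
    using that SD w by (auto simp: reach_iff)
  have t_iff: "(w, t) \<in> E\<^sup>* \<longleftrightarrow> (\<forall>i<lev w. bits t i = bits w i)" if "t \<in> T" for t
    using that TD w lev_le[OF w] by (auto simp: reach_iff)
  show ?thesis
  proof
    assume lev: "lev w = m"
    obtain s where s: "s \<in> S" "\<forall>i<h. m \<le> i \<longrightarrow> bits s i = bits w i"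
      using source_transversal_ex[OF S, of "bits w"] by blast
    obtain t where t: "t \<in> T" "\<forall>i<m. bits t i = bits w i"
      using target_transversal_ex[OF m T, of "bits w"] by blast
    have "\<exists>!s. s \<in> S \<and> (s, w) \<in> E\<^sup>*"
    proof (rule ex1I[of _ s])
      show "s \<in> S \<and> (s, w) \<in> E\<^sup>*" using s s_iff lev by simp
      fix s' assume "s' \<in> S \<and> (s', w) \<in> E\<^sup>*"
      then have "s' \<in> S" "\<forall>i<h. m \<le> i \<longrightarrow> bits s' i = bits s i" using s s_iff lev by auto
      then show "s' = s" using SD s(1) by blast
    qed
    moreover have "\<exists>!t. t \<in> T \<and> (w, t) \<in> E\<^sup>*"
    proof (rule ex1I[of _ t])
      show "t \<in> T \<and> (w, t) \<in> E\<^sup>*" using t t_iff lev by simp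
      fix t' assume "t' \<in> T \<and> (w, t') \<in> E\<^sup>*"
      then have "t' \<in> T" "\<forall>i<m. bits t' i = bits t i" using t t_iff lev by auto
      then show "t' = t" using TD t(1) by blast
    qed
    ultimately show "(\<exists>!s. s \<in> S \<and> (s, w) \<in> E\<^sup>*) \<and> (\<exists>!t. t \<in> T \<and> (w, t) \<in> E\<^sup>*)" ..
  next
    assume uniq: "(\<exists>!s. s \<in> S \<and> (s, w) \<in> E\<^sup>*) \<and> (\<exists>!t. t \<in> T \<and> (w, t) \<in> E\<^sup>*)"
    show "lev w = m"
    proof (rule ccontr)
      assume "lev w \<noteq> m"
      then consider "lev w < m" | "m < lev w" by linarith
      then show False
      proof cases
        case 1
        have "\<exists>t\<in>T. (w, t) \<in> E\<^sup>* \<and> bits t (lev w) = b" for b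
        proof -
          obtain t where "t \<in> T" "\<forall>i<m. bits t i = (if i = lev w then b else bits w i)"
            using target_transversal_ex[OF m T, of "\<lambda>i. if i = lev w then b else bits w i"] by blast
          then show ?thesis using 1 t_iff by (intro bexI[of _ t]) auto
        qed
        from this[of True] this[of False] show False using uniq by metis
      next
        case 2
        have "\<exists>s\<in>S. (s, w) \<in> E\<^sup>* \<and> bits s (lev w - 1) = b" for b
        proof -
          obtain s where "s \<in> S" "\<forall>i<h. m \<le> i \<longrightarrow> bits s i = (if i = lev w - 1 then b else bits w i)"
            using source_transversal_ex[OF S, of "\<lambda>i. if i = lev w - 1 then b else bits w i"] by blast
          then show ?thesis using 2 s_iff lev_le[OF w] by (intro bexI[of _ s]) auto
        qed
        from this[of True] this[of False] show False using uniq by metis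
      qed
    qed
  qed
qed

section \<open>Pairs inside the small butterflies\<close>

definition lower_pairs :: "nat \<Rightarrow> ('v \<times> 'v) set" where
  "lower_pairs m = {(u, v) \<in> V \<times> V. lev u \<le> m \<and> lev v \<le> m \<and> (\<forall>i<h. m \<le> i \<longrightarrow> bits u i = bits v i)}"

definition upper_pairs :: "nat \<Rightarrow> ('v \<times> 'v) set" where
  "upper_pairs m = {(u, v) \<in> V \<times> V. m \<le> lev u \<and> m \<le> lev v \<and> (\<forall>i<m. bits u i = bits v i)}"

lemma lower_pairs_converse:
  assumes "m \<le> h"
  shows "butterfly_coords.lower_pairs h V (\<lambda>v. h - lev v) (\<lambda>v i. bits v (h - 1 - i)) (h - m)
    = upper_pairs m"
proof -
  interpret D: butterfly_coords h V "E\<inverse>" "\<lambda>v. h - lev v" "\<lambda>v i. bits v (h - 1 - i)"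
    by (rule coords_converse)
  have lev: "h - lev v \<le> h - m \<longleftrightarrow> m \<le> lev v" if "v \<in> V" for v
    using that lev_le[of v] assms by auto
  show ?thesis
    unfolding D.lower_pairs_def upper_pairs_def all_rev_ge_iff[OF assms, of "\<lambda>i. bits _ i = bits _ i"]
    using lev by auto
qed

text \<open>A pair is fixed by two levels, all bits of \<open>u\<close> and the first
  \<open>m\<close> bits of \<open>v\<close>, the other bits of \<open>v\<close> being shared with
  \<open>u\<close>.\<close>

lemma card_lower_pairs_le:
  assumes "m \<le> h"
  shows "card (lower_pairs m) \<le> (m + 1)\<^sup>2 * 2 ^ (h + m)"
proof -
  let ?B = "{(u, v) \<in> V \<times> V. lev u \<le> m \<and> lev v \<le> m \<and> (\<forall>i<h. m \<le> i \<longrightarrow> bits u i = bits v i)}"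
  let ?f = "\<lambda>(u, v). ((lev u, lev v), {i. i < h \<and> bits u i}, {i. i < m \<and> bits v i})"
  have "inj_on ?f ?B"
  proof (rule inj_onI, clarify)
    fix u v u' v'
    assume B: "u \<in> V" "v \<in> V" "u' \<in> V" "v' \<in> V"
      and eq: "\<forall>i<h. m \<le> i \<longrightarrow> bits u i = bits v i" "\<forall>i<h. m \<le> i \<longrightarrow> bits u' i = bits v' i"
      and lev: "lev u = lev u'" "lev v = lev v'"
      and bits: "{i. i < h \<and> bits u i} = {i. i < h \<and> bits u' i}"
        "{i. i < m \<and> bits v i} = {i. i < m \<and> bits v' i}"
    have u: "bits u i = bits u' i" if "i < h" for i using bits(1) that by blast
    have v: "bits v i = bits v' i" if "i < h" for i
      using bits(2) eq u[OF that] that by (cases "i < m") (blast, simp)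
    show "u = u' \<and> v = v'" using vertex_eqI B lev u v by blast
  qed
  moreover have "?f ` ?B \<subseteq> ({..m} \<times> {..m}) \<times> Pow {..<h} \<times> Pow {..<m}" by auto
  ultimately have "card ?B \<le> card (({..m} \<times> {..m}) \<times> Pow {..<h} \<times> Pow {..<m})"
    by (rule card_inj_on_le) simp
  also have "\<dots> = (m + 1)\<^sup>2 * 2 ^ (h + m)"
    by (simp add: card_cartesian_product card_Pow power2_eq_square power_add)
  finally show ?thesis unfolding lower_pairs_def .
qed

lemma card_upper_pairs_le:
  assumes "m \<le> h"
  shows "card (upper_pairs m) \<le> (h - m + 1)\<^sup>2 * 2 ^ (h + (h - m))"
proof -
  interpret D: butterfly_coords h V "E\<inverse>" "\<lambda>v. h - lev v" "\<lambda>v i. bits v (h - 1 - i)"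
    by (rule coords_converse)
  show ?thesis
    using D.card_lower_pairs_le[of "h - m"] lower_pairs_converse[OF assms] by simp
qed

text \<open>The class of \<open>x\<close> is that of the source below any level-\<open>m\<close>
  vertex above \<open>x\<close>. Looking only below one target \<open>\<tau> x\<close> keeps the
  candidates few, by \<open>card_cone_le\<close>. The choice is constrained only where a target of
  \<open>T\<close> lies above \<open>x\<close>; this includes all vertices of level at most
  \<open>m\<close>.\<close>

lemma lower_pairs_middle:
  assumes m: "m \<le> h" and S: "source_transversal m S" and T: "target_transversal m T"
    and \<tau>: "\<And>v. v \<in> V \<Longrightarrow> (\<exists>t\<in>T. (v, t) \<in> E\<^sup>*) \<Longrightarrow> \<tau> v \<in> T \<and> (v, \<tau> v) \<in> E\<^sup>*"
  shows "(u, v) \<in> lower_pairs m \<longleftrightarrow> u \<in> V \<and> v \<in> V \<and> (\<exists>s\<in>S. \<forall>x\<in>{u, v}. \<exists>w\<in>V.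
    lev w = m \<and> (s, w) \<in> E\<^sup>* \<and> (x, w) \<in> E\<^sup>* \<and> \<tau> x \<in> T \<and> (x, \<tau> x) \<in> E\<^sup>* \<and> (w, \<tau> x) \<in> E\<^sup>*)"
    (is "_ \<longleftrightarrow> u \<in> V \<and> v \<in> V \<and> (\<exists>s\<in>S. \<forall>x\<in>{u, v}. ?M s x)")
proof -
  note SD = S[unfolded source_transversal_def]
  note TD = T[unfolded target_transversal_def]
  have M: "?M s x \<longleftrightarrow> lev x \<le> m \<and> (\<forall>i<h. m \<le> i \<longrightarrow> bits x i = bits s i)"
    if "s \<in> S" "x \<in> V" for s x
  proof
    have s: "s \<in> V" "lev s = 0" using that(1) SD by auto
    assume "?M s x"
    then obtain w where w: "w \<in> V" "lev w = m" "(s, w) \<in> E\<^sup>*" "(x, w) \<in> E\<^sup>*" by blast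
    then show "lev x \<le> m \<and> (\<forall>i<h. m \<le> i \<longrightarrow> bits x i = bits s i)"
      using s that(2) by (simp add: reach_iff)
  next
    have s: "s \<in> V" "lev s = 0" using that(1) SD by auto
    assume x: "lev x \<le> m \<and> (\<forall>i<h. m \<le> i \<longrightarrow> bits x i = bits s i)"
    obtain t where t: "t \<in> T" "\<forall>i<m. bits t i = bits x i"
      using target_transversal_ex[OF m T, of "bits x"] by blast
    have "(x, t) \<in> E\<^sup>*"
      using t x TD that(2) lev_le[OF that(2)] by (intro reachI) auto
    then have \<tau>x: "\<tau> x \<in> T" "(x, \<tau> x) \<in> E\<^sup>*" using \<tau>[OF that(2)] t(1) by auto
    then have \<tau>V: "\<tau> x \<in> V" "lev (\<tau> x) = h" using TD by auto
    have agree: "bits x i = bits (\<tau> x) i" if "i < lev x" "i < h" for i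
      using \<tau>x(2) \<tau>V \<open>x \<in> V\<close> that by (simp add: reach_iff)
    \<comment> \<open>The vertex where a path from \<open>x\<close> to \<open>\<tau> x\<close> can
      cross level \<open>m\<close> without leaving the class of \<open>x\<close>.\<close>
    obtain w where w: "w \<in> V" "lev w = m" "\<forall>i<h. bits w i = (if i < m then bits (\<tau> x) i else bits x i)"
      using ex_vertex[OF m, of "\<lambda>i. if i < m then bits (\<tau> x) i else bits x i"] by blast
    have "(s, w) \<in> E\<^sup>*" using s w x by (intro reachI) auto
    moreover have "(x, w) \<in> E\<^sup>*" using agree w x that(2) by (intro reachI) auto
    moreover have "(w, \<tau> x) \<in> E\<^sup>*" using \<tau>V w m by (intro reachI) auto
    ultimately show "?M s x" using w \<tau>x by blast
  qed
  show ?thesis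
  proof
    assume "(u, v) \<in> lower_pairs m"
    then have uv: "u \<in> V" "v \<in> V" "lev u \<le> m" "lev v \<le> m" "\<forall>i<h. m \<le> i \<longrightarrow> bits u i = bits v i"
      by (auto simp: lower_pairs_def)
    obtain s where "s \<in> S" "\<forall>i<h. m \<le> i \<longrightarrow> bits s i = bits u i"
      using source_transversal_ex[OF S, of "bits u"] by blast
    then show "u \<in> V \<and> v \<in> V \<and> (\<exists>s\<in>S. \<forall>x\<in>{u, v}. ?M s x)"
      using uv M[of s u] M[of s v] by (intro conjI bexI[of _ s]) auto
  next
    assume R: "u \<in> V \<and> v \<in> V \<and> (\<exists>s\<in>S. \<forall>x\<in>{u, v}. ?M s x)"
    then obtain s where "s \<in> S" "?M s u" "?M s v" by blast
    then show "(u, v) \<in> lower_pairs m"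
      using R M[of s u] M[of s v] by (simp add: lower_pairs_def)
  qed
qed

text \<open>Edges form the covering relation of reachability. Restricting to pairs on one side of
  level \<open>m\<close> loses nothing: an edge never straddles that level, and between related
  vertices of one piece whose levels differ by more than one lies a third vertex of the same
  piece.\<close>

lemma edge_iff_cover:
  assumes "m \<le> h"
  defines "D \<equiv> (lower_pairs m \<union> upper_pairs m) \<inter> E\<^sup>*"
  shows "(u, v) \<in> E \<longleftrightarrow> (u, v) \<in> D \<and> u \<noteq> v \<and>
    \<not> (\<exists>w. w \<noteq> u \<and> w \<noteq> v \<and> (u, w) \<in> D \<and> (w, v) \<in> D)"
proof
  assume uv: "(u, v) \<in> E"
  then have V: "u \<in> V" "v \<in> V" and lev: "lev v = Suc (lev u)"
    and eq: "\<And>i. i < h \<Longrightarrow> i \<noteq> lev u \<Longrightarrow> bits u i = bits v i" by (auto simp: edge_iff)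
  have "lev v \<le> h" using lev_le[OF V(2)] .
  have "(u, v) \<in> lower_pairs m \<union> upper_pairs m"
  proof (cases "lev v \<le> m")
    case True
    then show ?thesis using V lev eq by (auto simp: lower_pairs_def)
  next
    case False
    then show ?thesis using V lev eq \<open>lev v \<le> h\<close> by (auto simp: upper_pairs_def)
  qed
  moreover have False if "w \<noteq> u" "w \<noteq> v" "(u, w) \<in> E\<^sup>*" "(w, v) \<in> E\<^sup>*" for w
  proof -
    have w: "w \<in> V" using reachD[OF that(3) V(1)] by blast
    have strict: "lev x \<noteq> lev y" if "x \<in> V" "y \<in> V" "(x, y) \<in> E\<^sup>*" "x \<noteq> y" for x y
    proof
      assume "lev x = lev y"
      then have "(y, x) \<in> E\<^sup>*" using that by (auto simp: reach_iff)
      then show False using antisymD[OF antisym_reach] that by blast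
    qed
    have "lev u < lev w" "lev w < lev v"
      using strict[of u w] strict[of w v] that V w reachD[OF that(3) V(1)] reachD[OF that(4) w]
      by auto
    then show False using lev by simp
  qed
  ultimately show "(u, v) \<in> D \<and> u \<noteq> v \<and> \<not> (\<exists>w. w \<noteq> u \<and> w \<noteq> v \<and> (u, w) \<in> D \<and> (w, v) \<in> D)"
    using uv lev unfolding D_def by auto
next
  assume R: "(u, v) \<in> D \<and> u \<noteq> v \<and> \<not> (\<exists>w. w \<noteq> u \<and> w \<noteq> v \<and> (u, w) \<in> D \<and> (w, v) \<in> D)"
  then have V: "u \<in> V" "v \<in> V" and uv: "(u, v) \<in> E\<^sup>*" "u \<noteq> v"
    by (auto simp: D_def lower_pairs_def upper_pairs_def)
  have eq: "lev u \<le> lev v" "\<And>i. i < h \<Longrightarrow> i < lev u \<or> lev v \<le> i \<Longrightarrow> bits u i = bits v i"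
    using uv(1) reach_iff[OF V] by auto
  have "lev v \<le> h" using lev_le[OF V(2)] .
  have "lev u \<noteq> lev v"
  proof
    assume "lev u = lev v"
    then show False using vertex_eqI[OF V] eq(2) uv(2) by (metis not_less)
  qed
  have "lev v = Suc (lev u)"
  proof (rule ccontr)
    assume "lev v \<noteq> Suc (lev u)"
    then have lt: "Suc (lev u) < lev v" using eq(1) \<open>lev u \<noteq> lev v\<close> by simp
    then have "Suc (lev u) \<le> h" using \<open>lev v \<le> h\<close> by simp
    \<comment> \<open>The first vertex after \<open>u\<close> on a path to \<open>v\<close>: bit
      \<open>lev u\<close> already has its value from \<open>v\<close>.\<close>
    then obtain w where w: "w \<in> V" "lev w = Suc (lev u)"
      "\<forall>i<h. bits w i = (if i < Suc (lev u) then bits v i else bits u i)"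
      using ex_vertex[of "Suc (lev u)" "\<lambda>i. if i < Suc (lev u) then bits v i else bits u i"] by blast
    have "(u, w) \<in> E\<^sup>*" using V w eq(2) by (intro reachI) auto
    moreover have "(w, v) \<in> E\<^sup>*" using V w eq(2) lt by (intro reachI) auto
    moreover consider "(u, v) \<in> lower_pairs m" | "(u, v) \<in> upper_pairs m"
      using R by (auto simp: D_def)
    then have "(u, w) \<in> lower_pairs m \<union> upper_pairs m \<and> (w, v) \<in> lower_pairs m \<union> upper_pairs m"
    proof cases
      case 1
      then have "(u, w) \<in> lower_pairs m \<and> (w, v) \<in> lower_pairs m"
        using w lt by (auto simp: lower_pairs_def)
      then show ?thesis by blast
    next
      case 2
      then have "(u, w) \<in> upper_pairs m \<and> (w, v) \<in> upper_pairs m"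
        using w lt \<open>m \<le> h\<close> by (auto simp: upper_pairs_def)
      then show ?thesis by blast
    qed
    moreover have "w \<noteq> u" "w \<noteq> v" using w(2) lt by auto
    ultimately have "(u, w) \<in> D \<and> (w, v) \<in> D \<and> w \<noteq> u \<and> w \<noteq> v"
      unfolding D_def by blast
    then show False using R by blast
  qed
  then show "(u, v) \<in> E" using edge_iff_reach V uv(1) by blast
qed

end

section \<open>The search\<close>

text \<open>Coordinates depend on \<open>E\<close> and serve the analysis only; the search never
  sees them. Finiteness of \<open>V\<close> is stated apart because \<open>P\<close> may be
  empty.\<close>

definition butterfly_family :: "nat \<Rightarrow> 'v set \<Rightarrow> ('v \<times> 'v) set set \<Rightarrow>
    (('v \<times> 'v) set \<Rightarrow> 'v \<Rightarrow> nat) \<Rightarrow> (('v \<times> 'v) set \<Rightarrow> 'v \<Rightarrow> nat \<Rightarrow> bool) \<Rightarrow> bool" where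
  "butterfly_family h V P lev bits \<longleftrightarrow> finite V \<and> (\<forall>E\<in>P. butterfly_coords h V E (lev E) (bits E))"

lemma butterfly_familyD:
  "butterfly_family h V P lev bits \<Longrightarrow> E \<in> P \<Longrightarrow> butterfly_coords h V E (lev E) (bits E)"
  unfolding butterfly_family_def by blast

lemma butterfly_family_subset:
  "butterfly_family h V P lev bits \<Longrightarrow> P' \<subseteq> P \<Longrightarrow> butterfly_family h V P' lev bits"
  unfolding butterfly_family_def by blast

lemma butterfly_family_converse:
  "butterfly_family h V P lev bits \<Longrightarrow> butterfly_family h V (converse ` P)
    (\<lambda>E v. h - lev (E\<inverse>) v) (\<lambda>E v i. bits (E\<inverse>) v (h - 1 - i))"
  unfolding butterfly_family_def
  by (simp del: One_nat_def diff_diff_left) (blast intro: butterfly_coords.coords_converse)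

text \<open>A vertex minimal for reachability is a source, because the level-0 vertex with the same
  bits lies below it.\<close>

lemma finds_source:
  assumes fam: "butterfly_family h V P lev bits" and "v \<in> V"
  shows "finds P (card V) (\<lambda>E s. s \<in> V \<and> lev E s = 0 \<and> (s, v) \<in> E\<^sup>*)"
proof -
  have "finds P (card V) (\<lambda>E x. x \<in> insert v V \<and> (x, v) \<in> E\<^sup>*
      \<and> (\<forall>w\<in>V. (w, x) \<in> E\<^sup>* \<longrightarrow> w = x))"
    using fam unfolding butterfly_family_def
    by (intro finds_minimal) (auto intro: butterfly_coords.antisym_reach)
  then show ?thesis
  proof (rule finds_map[where f = "\<lambda>x. x"])
    fix E x assume "E \<in> P"
      and x: "x \<in> insert v V \<and> (x, v) \<in> E\<^sup>* \<and> (\<forall>w\<in>V. (w, x) \<in> E\<^sup>* \<longrightarrow> w = x)"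
    interpret butterfly_coords h V E "lev E" "bits E"
      using butterfly_familyD[OF fam \<open>E \<in> P\<close>] .
    have "x \<in> V" using x \<open>v \<in> V\<close> by blast
    obtain w where w: "w \<in> V" "lev E w = 0" "\<forall>i<h. bits E w i = bits E x i"
      using ex_vertex[of 0 "bits E x"] by blast
    then have "(w, x) \<in> E\<^sup>*" using \<open>x \<in> V\<close> by (intro reachI) auto
    then have "w = x" using w(1) x by blast
    then show "x \<in> V \<and> lev E x = 0 \<and> (x, v) \<in> E\<^sup>*" using w(1,2) x by simp
  qed
qed

lemma finds_target:
  assumes fam: "butterfly_family h V P lev bits" and "v \<in> V"
  shows "finds P (card V) (\<lambda>E t. t \<in> V \<and> lev E t = h)"
proof (rule finds_dual[OF finds_source[OF butterfly_family_converse[OF fam] \<open>v \<in> V\<close>]])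
  fix E t assume "E \<in> P" and "t \<in> V \<and> h - lev ((E\<inverse>)\<inverse>) t = 0 \<and> (t, v) \<in> (E\<inverse>)\<^sup>*"
  then show "t \<in> V \<and> lev E t = h"
    using butterfly_coords.lev_le[OF butterfly_familyD[OF fam \<open>E \<in> P\<close>], of t] by simp
qed

text \<open>Comparing all vertices with \<open>s\<close> and \<open>t\<close> isolates the
  \<open>h + 1\<close> vertices of the path; querying all pairs among these orders them.\<close>

lemma finds_crossing:
  assumes fam: "butterfly_family h V P lev bits" and "s \<in> V" "t \<in> V" "m \<le> h"
    and st: "\<And>E. E \<in> P \<Longrightarrow> lev E s = 0 \<and> lev E t = h"
  shows "finds P (2 * card V + (h + 1)\<^sup>2)
    (\<lambda>E p. p \<in> V \<and> lev E p = m \<and> (s, p) \<in> E\<^sup>* \<and> (p, t) \<in> E\<^sup>*)" (is "finds P _ ?Q")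
proof (rule finds_bind)
  let ?S = "{s} \<times> V \<union> V \<times> {t}"
  have "finite V" using fam by (simp add: butterfly_family_def)
  have "card ?S \<le> card ({s} \<times> V) + card (V \<times> {t})" by (rule card_Un_le)
  then show "finds P (2 * card V) (\<lambda>E Y. Y = ?S \<inter> E\<^sup>*)"
    using \<open>finite V\<close> by (intro finds_scan_le) (auto simp: card_cartesian_product)
  fix Y
  let ?P = "{E \<in> P. Y = ?S \<inter> E\<^sup>*}"
  define X where "X = {w \<in> V. (s, w) \<in> Y \<and> (w, t) \<in> Y}"
  have X: "X = {w \<in> V. (s, w) \<in> E\<^sup>* \<and> (w, t) \<in> E\<^sup>*}" if "E \<in> ?P" for E
    using that by (auto simp: X_def)
  show "finds ?P ((h + 1)\<^sup>2) ?Q"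
  \<comment> \<open>The set \<open>X\<close> depends on \<open>Y\<close> alone, so any one graph
    consistent with \<open>Y\<close> determines its size.\<close>
  proof (cases "?P = {}")
    case False
    then obtain E where "E \<in> ?P" by blast
    then interpret butterfly_coords h V E "lev E" "bits E" using butterfly_familyD[OF fam] by blast
    have "card X = h + 1"
      using bij_betw_same_card[OF path_levels(1)[of s t]] X[OF \<open>E \<in> ?P\<close>] \<open>E \<in> ?P\<close> assms(2,3) st
      by simp
    then have "finds ?P ((h + 1)\<^sup>2) (\<lambda>E Z. Z = (X \<times> X) \<inter> E\<^sup>*)"
      using \<open>finite V\<close>
      by (intro finds_scan_le) (auto simp: X_def card_cartesian_product power2_eq_square)
    then show ?thesis
    \<comment> \<open>The count is \<open>Suc m\<close> because reachability is reflexive: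
      \<open>w\<close> itself is included.\<close>
    proof (rule finds_map[where f = "\<lambda>Z. SOME w. w \<in> X \<and> card {x \<in> X. (x, w) \<in> Z} = Suc m"])
      fix F Z assume F: "F \<in> ?P" and Z: "Z = (X \<times> X) \<inter> F\<^sup>*"
      interpret F: butterfly_coords h V F "lev F" "bits F" using butterfly_familyD[OF fam] F by blast
      have stF: "lev F s = 0" "lev F t = h" using st F by auto
      have cd: "card {x \<in> X. (x, w) \<in> Z} = Suc (lev F w)" if "w \<in> X" for w
      proof -
        have "{x \<in> X. (x, w) \<in> Z} = {x \<in> X. (x, w) \<in> F\<^sup>*}" using Z that by auto
        then show ?thesis
          using F.path_levels(2)[OF assms(2,3) stF, of w] X[OF F] that by simp
      qed
      have "m \<in> lev F ` X"
        using F.path_levels(1)[OF assms(2,3) stF] X[OF F] \<open>m \<le> h\<close> by (auto simp: bij_betw_def)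
      then have "\<exists>w. w \<in> X \<and> card {x \<in> X. (x, w) \<in> Z} = Suc m" using cd by auto
      from someI_ex[OF this] show "?Q F (SOME w. w \<in> X \<and> card {x \<in> X. (x, w) \<in> Z} = Suc m)"
        using cd X[OF F] by auto
    qed
  next
    case True
    then show ?thesis by (simp only: finds_empty)
  qed
qed

text \<open>The second component \<open>Z\<close> is the set of vertices below \<open>t\<close> that are incomparable to the
  level-\<open>m\<close> vertex of the path from \<open>s\<close> to \<open>t\<close>, for each source \<open>s\<close> found so far. Every source
  below a vertex of \<open>Z\<close> belongs to a new class.\<close>

definition source_search :: "nat \<Rightarrow> 'v set \<Rightarrow> (('v \<times> 'v) set \<Rightarrow> 'v \<Rightarrow> nat) \<Rightarrow>
    (('v \<times> 'v) set \<Rightarrow> 'v \<Rightarrow> nat \<Rightarrow> bool) \<Rightarrow> nat \<Rightarrow> 'v \<Rightarrow> nat \<Rightarrow> ('v \<times> 'v) set \<Rightarrow> 'v set \<times> 'v set \<Rightarrow> bool"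
  where "source_search h V lev bits m t j E = (\<lambda>(S, Z).
    S \<subseteq> V \<and> card S = j \<and> (\<forall>s\<in>S. lev E s = 0) \<and>
    (\<forall>s\<in>S. \<forall>s'\<in>S. (\<forall>i<h. m \<le> i \<longrightarrow> bits E s i = bits E s' i) \<longrightarrow> s = s') \<and>
    Z = {v \<in> V. (v, t) \<in> E\<^sup>* \<and> (\<forall>s\<in>S. \<exists>i<h. max (lev E v) m \<le> i \<and> bits E v i \<noteq> bits E s i)})"

text \<open>One round costs \<open>card V\<close> for a source \<open>s\<close> below some
  \<open>v\<close> in \<open>Z\<close>, then the price of the crossing vertex \<open>p\<close>, then
  \<open>2 * card V\<close> to compare \<open>p\<close> with everything and shrink \<open>Z\<close>
  by \<open>comparable_iff\<close>.\<close>

lemma finds_source_step: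
  assumes fam: "butterfly_family h V P lev bits" and "t \<in> V" "m \<le> h" "j < 2 ^ (h - m)"
    and P: "\<And>E. E \<in> P \<Longrightarrow> lev E t = h \<and> source_search h V lev bits m t j E (S, Z)"
  shows "finds P (5 * card V + (h + 1)\<^sup>2) (source_search h V lev bits m t (Suc j))" (is "finds P _ ?Q")
proof (cases "P = {}")
  case True
  then show ?thesis by (simp only: finds_empty)
next
  case False
  then obtain E where "E \<in> P" by blast
  have "finite V" using fam by (simp add: butterfly_family_def)
  have SD: "S \<subseteq> V" "card S = j" "\<forall>s\<in>S. lev F s = 0"
    "\<forall>s\<in>S. \<forall>s'\<in>S. (\<forall>i<h. m \<le> i \<longrightarrow> bits F s i = bits F s' i) \<longrightarrow> s = s'"
    "Z = {v \<in> V. (v, t) \<in> F\<^sup>* \<and> (\<forall>s\<in>S. \<exists>i<h. max (lev F v) m \<le> i \<and> bits F v i \<noteq> bits F s i)}"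
    if "F \<in> P" for F
    using P[OF that] unfolding source_search_def by auto
  have "finite S" using SD(1)[OF \<open>E \<in> P\<close>] \<open>finite V\<close> by (rule finite_subset)
  \<comment> \<open>A source with a pattern missed by \<open>S\<close> belongs to \<open>Z\<close>,
    since every source lies below every target.\<close>
  have "Z \<noteq> {}"
  proof -
    interpret butterfly_coords h V E "lev E" "bits E" using butterfly_familyD[OF fam \<open>E \<in> P\<close>] .
    obtain f where f: "\<forall>s\<in>S. \<exists>i<h. m \<le> i \<and> bits E s i \<noteq> f i"
      using ex_missing_pattern[OF \<open>finite S\<close>, of m] SD(2)[OF \<open>E \<in> P\<close>] \<open>j < _\<close> by blast
    obtain v where v: "v \<in> V" "lev E v = 0" "\<forall>i<h. bits E v i = f i"
      using ex_vertex[of 0 f] by blast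
    have "(v, t) \<in> E\<^sup>*"
      using v \<open>t \<in> V\<close> P[OF \<open>E \<in> P\<close>] by (intro reachI) auto
    moreover have "\<exists>i<h. max (lev E v) m \<le> i \<and> bits E v i \<noteq> bits E s i" if "s \<in> S" for s
      using f that v by (metis max_0L)
    ultimately have "v \<in> Z" using SD(5)[OF \<open>E \<in> P\<close>] v(1) by blast
    then show ?thesis by blast
  qed
  then obtain v where "v \<in> Z" by blast
  then have "v \<in> V" using SD(5)[OF \<open>E \<in> P\<close>] by blast
  have "finds P (card V + ((2 * card V + (h + 1)\<^sup>2) + 2 * card V)) ?Q"
  proof (rule finds_bind[OF finds_source[OF fam \<open>v \<in> V\<close>]], rule finds_bind)
    fix s
    let ?P1 = "{E \<in> P. s \<in> V \<and> lev E s = 0 \<and> (s, v) \<in> E\<^sup>*}"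
    have "finds ?P1 (2 * card V + (h + 1)\<^sup>2)
        (\<lambda>E p. p \<in> V \<and> lev E p = m \<and> (s, p) \<in> E\<^sup>* \<and> (p, t) \<in> E\<^sup>*)" if "s \<in> V"
      by (rule finds_crossing[OF butterfly_family_subset[OF fam]])
        (use that assms(2,3) P in auto)
    then show "finds ?P1 (2 * card V + (h + 1)\<^sup>2)
        (\<lambda>E p. p \<in> V \<and> lev E p = m \<and> (s, p) \<in> E\<^sup>* \<and> (p, t) \<in> E\<^sup>*)"
      by (cases "s \<in> V") (simp_all add: finds_empty)
    fix p
    let ?P2 = "{E \<in> ?P1. p \<in> V \<and> lev E p = m \<and> (s, p) \<in> E\<^sup>* \<and> (p, t) \<in> E\<^sup>*}"
    let ?S = "{p} \<times> V \<union> V \<times> {p}"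
    have "card ?S \<le> card ({p} \<times> V) + card (V \<times> {p})" by (rule card_Un_le)
    then have "finds ?P2 (2 * card V) (\<lambda>E Y. Y = ?S \<inter> E\<^sup>*)"
      using \<open>finite V\<close> by (intro finds_scan_le) (auto simp: card_cartesian_product)
    then show "finds ?P2 (2 * card V) ?Q"
    proof (rule finds_map[where f = "\<lambda>Y. (insert s S, {x \<in> Z. (p, x) \<notin> Y \<and> (x, p) \<notin> Y})"])
      fix F Y assume F: "F \<in> ?P2" and Y: "Y = ?S \<inter> F\<^sup>*"
      then have "F \<in> P" and s: "s \<in> V" "lev F s = 0" "(s, v) \<in> F\<^sup>*"
        and p: "p \<in> V" "lev F p = m" "(s, p) \<in> F\<^sup>*" "(p, t) \<in> F\<^sup>*" by auto
      interpret butterfly_coords h V F "lev F" "bits F" using butterfly_familyD[OF fam \<open>F \<in> P\<close>] .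
      note SD = SD[OF \<open>F \<in> P\<close>]
      have t: "lev F t = h" using P[OF \<open>F \<in> P\<close>] by blast
      \<comment> \<open>A vertex of \<open>Z\<close> differs from \<open>s'\<close> at some bit that
        is at least both \<open>m\<close> and its level; a source below it inherits this
        bit.\<close>
      have new: "\<exists>i<h. m \<le> i \<and> bits F s i \<noteq> bits F s' i" if "s' \<in> S" for s'
      proof -
        obtain i where "i < h" "max (lev F v) m \<le> i" "bits F v i \<noteq> bits F s' i"
          using \<open>v \<in> Z\<close> SD(5) \<open>s' \<in> S\<close> by blast
        then show ?thesis
          using comparable_source[OF s(1,2) \<open>v \<in> V\<close> s(3), of i] by (intro exI[of _ i]) simp
      qed
      then have "s \<notin> S" by blast
      have "x \<in> Z \<and> (p, x) \<notin> Y \<and> (x, p) \<notin> Y \<longleftrightarrow> x \<in> V \<and> (x, t) \<in> F\<^sup>* \<and>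
          (\<forall>s\<in>insert s S. \<exists>i<h. max (lev F x) m \<le> i \<and> bits F x i \<noteq> bits F s i)" for x
        using comparable_iff[OF s(1) \<open>t \<in> V\<close> s(2) t p, of x] SD(5) p(1) Y by auto
      then have Z: "{x \<in> Z. (p, x) \<notin> Y \<and> (x, p) \<notin> Y} = {x \<in> V. (x, t) \<in> F\<^sup>* \<and>
          (\<forall>s\<in>insert s S. \<exists>i<h. max (lev F x) m \<le> i \<and> bits F x i \<noteq> bits F s i)}"
        by blast
      have "insert s S \<subseteq> V" "card (insert s S) = Suc j" "\<forall>s\<in>insert s S. lev F s = 0"
        using SD(1-3) s \<open>s \<notin> S\<close> \<open>finite S\<close> by auto
      moreover have "\<forall>a\<in>insert s S. \<forall>b\<in>insert s S.
          (\<forall>i<h. m \<le> i \<longrightarrow> bits F a i = bits F b i) \<longrightarrow> a = b"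
        using SD(4) new by (metis insert_iff)
      ultimately show "?Q F (insert s S, {x \<in> Z. (p, x) \<notin> Y \<and> (x, p) \<notin> Y})"
        unfolding source_search_def using Z by simp
    qed
  qed
  then show ?thesis by (rule finds_mono) simp
qed

lemma finds_source_search:
  assumes fam: "butterfly_family h V P lev bits" and "t \<in> V" "m \<le> h" "j \<le> 2 ^ (h - m)"
    and t: "\<And>E. E \<in> P \<Longrightarrow> lev E t = h"
  shows "finds P (card V + j * (5 * card V + (h + 1)\<^sup>2)) (source_search h V lev bits m t j)"
  using \<open>j \<le> _\<close>
proof (induction j)
  case 0
  have "finite V" using fam by (simp add: butterfly_family_def)
  \<comment> \<open>With no source found yet, \<open>Z\<close> consists of all vertices below
    \<open>t\<close>; this is the initial \<open>card V\<close>.\<close>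
  then have "finds P (card V) (\<lambda>E Y. Y = (V \<times> {t}) \<inter> E\<^sup>*)"
    by (intro finds_scan_le) (auto simp: card_cartesian_product)
  then have "finds P (card V) (source_search h V lev bits m t 0)"
    by (rule finds_map[where f = "\<lambda>Y. ({}, {v \<in> V. (v, t) \<in> Y})"])
      (auto simp: source_search_def)
  then show ?case by simp
next
  case (Suc j)
  have "finds P ((card V + j * (5 * card V + (h + 1)\<^sup>2)) + (5 * card V + (h + 1)\<^sup>2))
      (source_search h V lev bits m t (Suc j))"
  proof (rule finds_bind[OF Suc.IH])
    fix x :: "'a set \<times> 'a set"
    obtain S Z where x: "x = (S, Z)" by (cases x)
    show "finds {E \<in> P. source_search h V lev bits m t j E x} (5 * card V + (h + 1)\<^sup>2)
        (source_search h V lev bits m t (Suc j))"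
      unfolding x
      by (rule finds_source_step[OF butterfly_family_subset[OF fam]])
        (use assms(2,3) Suc.prems t in auto)
  qed (use Suc.prems in simp)
  then show ?case by (rule finds_mono) simp
qed

lemma finds_source_transversal:
  assumes fam: "butterfly_family h V P lev bits" and "v \<in> V" "m \<le> h"
  shows "finds P (2 * card V + 2 ^ (h - m) * (5 * card V + (h + 1)\<^sup>2))
    (\<lambda>E S. butterfly_coords.source_transversal h V (lev E) (bits E) m S)" (is "finds P _ ?Q")
proof -
  have "finds P (card V + (card V + 2 ^ (h - m) * (5 * card V + (h + 1)\<^sup>2))) ?Q"
  proof (rule finds_bind[OF finds_target[OF fam \<open>v \<in> V\<close>]])
    fix t
    let ?P = "{E \<in> P. t \<in> V \<and> lev E t = h}"
    show "finds ?P (card V + 2 ^ (h - m) * (5 * card V + (h + 1)\<^sup>2)) ?Q"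
    proof (cases "t \<in> V")
      case True
      have "finds ?P (card V + 2 ^ (h - m) * (5 * card V + (h + 1)\<^sup>2))
          (source_search h V lev bits m t (2 ^ (h - m)))"
        by (rule finds_source_search[OF butterfly_family_subset[OF fam]])
          (use True \<open>m \<le> h\<close> in auto)
      then show ?thesis
      proof (rule finds_map[where f = fst])
        fix E x assume "E \<in> ?P" and x: "source_search h V lev bits m t (2 ^ (h - m)) E x"
        then have "E \<in> P" by blast
        then show "?Q E (fst x)"
          using x butterfly_familyD[OF fam \<open>E \<in> P\<close>]
          by (auto simp: source_search_def butterfly_coords.source_transversal_def)
      qed
    qed (simp add: finds_empty)
  qed
  then show ?thesis by (rule finds_mono) simp
qed

lemma finds_target_transversal:
  assumes fam: "butterfly_family h V P lev bits" and "v \<in> V" "m \<le> h"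
  shows "finds P (2 * card V + 2 ^ m * (5 * card V + (h + 1)\<^sup>2))
    (\<lambda>E T. butterfly_coords.target_transversal h V (lev E) (bits E) m T)"
proof (rule finds_dual)
  show "finds (converse ` P) (2 * card V + 2 ^ m * (5 * card V + (h + 1)\<^sup>2))
     (\<lambda>E. butterfly_coords.source_transversal h V (\<lambda>v. h - lev (E\<inverse>) v)
       (\<lambda>v i. bits (E\<inverse>) v (h - 1 - i)) (h - m))"
    using finds_source_transversal[OF butterfly_family_converse[OF fam] \<open>v \<in> V\<close>, of "h - m"] \<open>m \<le> h\<close>
    by simp
  fix E T
  assume "E \<in> P" and "butterfly_coords.source_transversal h V (\<lambda>v. h - lev ((E\<inverse>)\<inverse>) v)
       (\<lambda>v i. bits ((E\<inverse>)\<inverse>) v (h - 1 - i)) (h - m) T"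
  then show "butterfly_coords.target_transversal h V (lev E) (bits E) m T"
    using butterfly_coords.transversal_converse(1)[OF butterfly_familyD[OF fam]] \<open>m \<le> h\<close>
    by simp
qed

text \<open>Scanning \<open>S \<times> V\<close> and \<open>V \<times> T\<close> reveals the middle
  level and a target above each lower vertex; then each vertex is compared with at most
  \<open>2 ^ (h - m)\<close> middle ones.\<close>

lemma finds_lower_pairs:
  assumes fam: "butterfly_family h V P lev bits" and m: "m \<le> h"
    and ST: "\<And>E. E \<in> P \<Longrightarrow> butterfly_coords.source_transversal h V (lev E) (bits E) m S"
      "\<And>E. E \<in> P \<Longrightarrow> butterfly_coords.target_transversal h V (lev E) (bits E) m T"
  shows "finds P (card V * (2 * 2 ^ (h - m) + 2 ^ m))
    (\<lambda>E B. B = butterfly_coords.lower_pairs h V (lev E) (bits E) m)" (is "finds P _ ?Q")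
proof (cases "P = {}")
  case True
  then show ?thesis by (simp only: finds_empty)
next
  case False
  then obtain E0 where "E0 \<in> P" by blast
  have "finite V" using fam by (simp add: butterfly_family_def)
  have STc: "S \<subseteq> V" "card S = 2 ^ (h - m)" "T \<subseteq> V" "card T = 2 ^ m"
    using ST[OF \<open>E0 \<in> P\<close>] butterfly_familyD[OF fam \<open>E0 \<in> P\<close>]
    by (simp_all add: butterfly_coords.source_transversal_def butterfly_coords.target_transversal_def)
  then have "finite S" "finite T" using \<open>finite V\<close> finite_subset by blast+
  let ?A = "S \<times> V \<union> V \<times> T"
  have "finds P ((2 ^ (h - m) * card V + card V * 2 ^ m) + card V * 2 ^ (h - m)) ?Q"
  proof (rule finds_bind)
    have "card ?A \<le> card (S \<times> V) + card (V \<times> T)" by (rule card_Un_le)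
    then show "finds P (2 ^ (h - m) * card V + card V * 2 ^ m) (\<lambda>E Y. Y = ?A \<inter> E\<^sup>*)"
      using \<open>finite V\<close> \<open>finite S\<close> \<open>finite T\<close> STc
      by (intro finds_scan_le) (auto simp: card_cartesian_product)
    fix Y
    let ?P = "{E \<in> P. Y = ?A \<inter> E\<^sup>*}"
    define M where "M = {w \<in> V. (\<exists>!s. s \<in> S \<and> (s, w) \<in> Y) \<and> (\<exists>!t. t \<in> T \<and> (w, t) \<in> Y)}"
    \<comment> \<open>If no target of \<open>T\<close> lies above \<open>v\<close>, this value is
      arbitrary; the tests on \<open>\<tau> v\<close> inside \<open>Q\<close> guard against that
      case.\<close>
    define \<tau> where "\<tau> v = (SOME t. t \<in> T \<and> (v, t) \<in> Y)" for v
    define Q where "Q = Sigma V (\<lambda>v. {w \<in> M. \<tau> v \<in> T \<and> (v, \<tau> v) \<in> Y \<and> (w, \<tau> v) \<in> Y})"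
    have Y: "(s, w) \<in> Y \<longleftrightarrow> (s, w) \<in> E\<^sup>*" "(w, t) \<in> Y \<longleftrightarrow> (w, t) \<in> E\<^sup>*"
      if "E \<in> ?P" "s \<in> S" "t \<in> T" "w \<in> V" for E s t w using that by auto
    have M: "w \<in> M \<longleftrightarrow> w \<in> V \<and> lev E w = m" if "E \<in> ?P" for E w
    proof -
      from that have "E \<in> P" by blast
      interpret butterfly_coords h V E "lev E" "bits E" using butterfly_familyD[OF fam \<open>E \<in> P\<close>] .
      have "w \<in> M \<longleftrightarrow> w \<in> V \<and> (\<exists>!s. s \<in> S \<and> (s, w) \<in> E\<^sup>*) \<and> (\<exists>!t. t \<in> T \<and> (w, t) \<in> E\<^sup>*)"
        using that by (auto simp: M_def)
      then show ?thesis using middle_level_iff[OF m ST[OF \<open>E \<in> P\<close>], of w] by blast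
    qed
    show "finds ?P (card V * 2 ^ (h - m)) ?Q"
    proof (cases "?P = {}")
      case True
      then show ?thesis by (simp only: finds_empty)
    next
      case False
      then obtain E where E: "E \<in> ?P" by blast
      then have "E \<in> P" by blast
      interpret butterfly_coords h V E "lev E" "bits E" using butterfly_familyD[OF fam \<open>E \<in> P\<close>] .
      have "card {w \<in> M. \<tau> v \<in> T \<and> (v, \<tau> v) \<in> Y \<and> (w, \<tau> v) \<in> Y} \<le> 2 ^ (h - m)" for v
      proof (cases "\<tau> v \<in> T")
        case True
        then have t: "\<tau> v \<in> V" "lev E (\<tau> v) = h"
          using ST(2)[OF \<open>E \<in> P\<close>] by (auto simp: target_transversal_def)
        have "{w \<in> M. \<tau> v \<in> T \<and> (v, \<tau> v) \<in> Y \<and> (w, \<tau> v) \<in> Y}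
            \<subseteq> {w \<in> V. lev E w = m \<and> (w, \<tau> v) \<in> E\<^sup>*}"
          using E M[OF E] by auto
        then have "card {w \<in> M. \<tau> v \<in> T \<and> (v, \<tau> v) \<in> Y \<and> (w, \<tau> v) \<in> Y}
            \<le> card {w \<in> V. lev E w = m \<and> (w, \<tau> v) \<in> E\<^sup>*}"
          using \<open>finite V\<close> by (intro card_mono) auto
        then show ?thesis using card_cone_le[OF m t] by linarith
      qed simp
      moreover have "finite M" using \<open>finite V\<close> by (simp add: M_def)
      ultimately have "finite Q" "card Q \<le> card V * 2 ^ (h - m)"
        using \<open>finite V\<close> sum_bounded_above[of V "\<lambda>v. card {w \<in> M. \<tau> v \<in> T \<and> (v, \<tau> v) \<in> Y \<and> (w, \<tau> v) \<in> Y}"]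
        by (auto simp: Q_def card_SigmaI)
      then have "finds ?P (card V * 2 ^ (h - m)) (\<lambda>E D. D = Q \<inter> E\<^sup>*)"
        by (rule finds_scan_le)
      then show ?thesis
      proof (rule finds_map[where f = "\<lambda>D. {(u, v) \<in> V \<times> V. \<exists>s\<in>S. \<forall>x\<in>{u, v}. \<exists>w. (x, w) \<in> D \<and> (s, w) \<in> Y}"])
        fix F D assume F: "F \<in> ?P" and D: "D = Q \<inter> F\<^sup>*"
        then have "F \<in> P" by blast
        interpret F: butterfly_coords h V F "lev F" "bits F" using butterfly_familyD[OF fam \<open>F \<in> P\<close>] .
        have YF: "Y = ?A \<inter> F\<^sup>*" using F by blast
        have \<tau>: "\<tau> v \<in> T \<and> (v, \<tau> v) \<in> F\<^sup>*" if "v \<in> V" "\<exists>t\<in>T. (v, t) \<in> F\<^sup>*" for v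
        proof -
          have "\<exists>t. t \<in> T \<and> (v, t) \<in> Y" using that YF by blast
          from someI_ex[OF this] show ?thesis using YF unfolding \<tau>_def by blast
        qed
        have cross: "(\<exists>w. (x, w) \<in> D \<and> (s, w) \<in> Y) \<longleftrightarrow> (\<exists>w\<in>V. lev F w = m \<and> (s, w) \<in> F\<^sup>*
            \<and> (x, w) \<in> F\<^sup>* \<and> \<tau> x \<in> T \<and> (x, \<tau> x) \<in> F\<^sup>* \<and> (w, \<tau> x) \<in> F\<^sup>*)"
          if "x \<in> V" "s \<in> S" for x s
          using that M[OF F] by (auto simp: D Q_def YF)
        have "(u, v) \<in> V \<times> V \<and> (\<exists>s\<in>S. \<forall>x\<in>{u, v}. \<exists>w. (x, w) \<in> D \<and> (s, w) \<in> Y)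
            \<longleftrightarrow> (u, v) \<in> F.lower_pairs m" for u v
        proof (cases "u \<in> V \<and> v \<in> V")
          case True
          have "(\<exists>s\<in>S. \<forall>x\<in>{u, v}. \<exists>w. (x, w) \<in> D \<and> (s, w) \<in> Y) \<longleftrightarrow>
              (\<exists>s\<in>S. \<forall>x\<in>{u, v}. \<exists>w\<in>V. lev F w = m \<and> (s, w) \<in> F\<^sup>*
                \<and> (x, w) \<in> F\<^sup>* \<and> \<tau> x \<in> T \<and> (x, \<tau> x) \<in> F\<^sup>* \<and> (w, \<tau> x) \<in> F\<^sup>*)"
            by (intro bex_cong ball_cong refl cross) (use True in auto)
          then show ?thesis
            using F.lower_pairs_middle[OF m ST[OF \<open>F \<in> P\<close>] \<tau>, of u v] True by (simp only: mem_Sigma_iff simp_thms)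
        qed (auto simp: F.lower_pairs_def)
        then show "?Q F {(u, v) \<in> V \<times> V. \<exists>s\<in>S. \<forall>x\<in>{u, v}. \<exists>w. (x, w) \<in> D \<and> (s, w) \<in> Y}"
          by auto
      qed
    qed
  qed
  then show ?thesis by (rule finds_mono) (simp add: algebra_simps)
qed

text \<open>Reversal exchanges \<open>S\<close> with \<open>T\<close> and \<open>m\<close> with
  \<open>h - m\<close>.\<close>

lemma finds_upper_pairs:
  assumes fam: "butterfly_family h V P lev bits" and m: "m \<le> h"
    and ST: "\<And>E. E \<in> P \<Longrightarrow> butterfly_coords.source_transversal h V (lev E) (bits E) m S"
      "\<And>E. E \<in> P \<Longrightarrow> butterfly_coords.target_transversal h V (lev E) (bits E) m T"
  shows "finds P (card V * (2 * 2 ^ m + 2 ^ (h - m)))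
    (\<lambda>E B. B = butterfly_coords.upper_pairs V (lev E) (bits E) m)"
proof (rule finds_dual)
  let ?lev = "\<lambda>E v. h - lev (E\<inverse>) v" and ?bits = "\<lambda>E v i. bits (E\<inverse>) v (h - 1 - i)"
  have "finds (converse ` P) (card V * (2 * 2 ^ (h - (h - m)) + 2 ^ (h - m)))
     (\<lambda>E B. B = butterfly_coords.lower_pairs h V (?lev E) (?bits E) (h - m))"
  proof (rule finds_lower_pairs[OF butterfly_family_converse[OF fam]])
    fix E assume "E \<in> converse ` P"
    then have "E\<inverse> \<in> P" by auto
    note conv = butterfly_coords.transversal_converse[OF butterfly_familyD[OF fam this] m]
    show "butterfly_coords.source_transversal h V (?lev E) (?bits E) (h - m) T"
      "butterfly_coords.target_transversal h V (?lev E) (?bits E) (h - m) S"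
      using conv ST[OF \<open>E\<inverse> \<in> P\<close>] by auto
  qed simp
  then show "finds (converse ` P) (card V * (2 * 2 ^ m + 2 ^ (h - m)))
     (\<lambda>E B. B = butterfly_coords.lower_pairs h V (?lev E) (?bits E) (h - m))"
    using m by simp
  fix E B
  assume "E \<in> P" and "B = butterfly_coords.lower_pairs h V (?lev (E\<inverse>)) (?bits (E\<inverse>)) (h - m)"
  then show "B = butterfly_coords.upper_pairs V (lev E) (bits E) m"
    using butterfly_coords.lower_pairs_converse[OF butterfly_familyD[OF fam \<open>E \<in> P\<close>] m] by simp
qed

text \<open>Once \<open>B1\<close> and \<open>B2\<close> are known, all remaining graphs share the
  same small butterflies, whose pairs can be listed and scanned; \<open>edge_iff_cover\<close> then
  yields the edges.\<close>

lemma finds_edges: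
  assumes fam: "butterfly_family h V P lev bits" and m: "m \<le> h"
    and ST: "\<And>E. E \<in> P \<Longrightarrow> butterfly_coords.source_transversal h V (lev E) (bits E) m S"
      "\<And>E. E \<in> P \<Longrightarrow> butterfly_coords.target_transversal h V (lev E) (bits E) m T"
  shows "finds P (card V * (3 * 2 ^ m + 3 * 2 ^ (h - m)) +
    ((m + 1)\<^sup>2 * 2 ^ (h + m) + (h - m + 1)\<^sup>2 * 2 ^ (h + (h - m)))) (\<lambda>E F. F = E)"
    (is "finds P (_ + ?c) _")
proof -
  have "finds P (card V * (2 * 2 ^ (h - m) + 2 ^ m) + (card V * (2 * 2 ^ m + 2 ^ (h - m)) + ?c))
    (\<lambda>E F. F = E)"
  proof (rule finds_bind[OF finds_lower_pairs[OF fam m ST]], assumption, assumption, rule finds_bind)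
    fix B1
    let ?P1 = "{E \<in> P. B1 = butterfly_coords.lower_pairs h V (lev E) (bits E) m}"
    show "finds ?P1 (card V * (2 * 2 ^ m + 2 ^ (h - m)))
        (\<lambda>E B. B = butterfly_coords.upper_pairs V (lev E) (bits E) m)"
      by (rule finds_upper_pairs[OF butterfly_family_subset[OF fam] m]) (use ST in auto)
    fix B2
    let ?P2 = "{E \<in> ?P1. B2 = butterfly_coords.upper_pairs V (lev E) (bits E) m}"
    show "finds ?P2 ?c (\<lambda>E F. F = E)"
    proof (cases "?P2 = {}")
      case True
      then show ?thesis by (simp only: finds_empty)
    next
      case False
      then obtain E where E: "E \<in> ?P2" by blast
      then interpret butterfly_coords h V E "lev E" "bits E" using butterfly_familyD[OF fam] by blast
      have B: "B1 = lower_pairs m" "B2 = upper_pairs m" using E by auto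
      have "card (B1 \<union> B2) \<le> ?c"
        unfolding B
        by (rule order_trans[OF card_Un_le add_mono[OF card_lower_pairs_le[OF m] card_upper_pairs_le[OF m]]])
      moreover have "B1 \<union> B2 \<subseteq> V \<times> V" by (auto simp: B lower_pairs_def upper_pairs_def)
      then have "finite (B1 \<union> B2)" using finite_V by (meson finite_SigmaI finite_subset)
      ultimately have "finds ?P2 ?c (\<lambda>E D. D = (B1 \<union> B2) \<inter> E\<^sup>*)" by (intro finds_scan_le)
      then show ?thesis
      proof (rule finds_map[where f = "\<lambda>D. {(u, v). (u, v) \<in> D \<and> u \<noteq> v \<and>
          \<not> (\<exists>w. w \<noteq> u \<and> w \<noteq> v \<and> (u, w) \<in> D \<and> (w, v) \<in> D)}"])
        fix F D assume F: "F \<in> ?P2" and D: "D = (B1 \<union> B2) \<inter> F\<^sup>*"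
        interpret F: butterfly_coords h V F "lev F" "bits F" using butterfly_familyD[OF fam] F by blast
        have "D = (F.lower_pairs m \<union> F.upper_pairs m) \<inter> F\<^sup>*" using F D by blast
        then show "{(u, v). (u, v) \<in> D \<and> u \<noteq> v \<and>
          \<not> (\<exists>w. w \<noteq> u \<and> w \<noteq> v \<and> (u, w) \<in> D \<and> (w, v) \<in> D)} = F"
          using F.edge_iff_cover[OF m] by auto
      qed
    qed
  qed
  then show ?thesis by (rule finds_mono) (simp add: algebra_simps)
qed

lemma finds_butterfly:
  assumes fam: "butterfly_family h V P lev bits" and m: "m \<le> h" and "v \<in> V"
  shows "finds P (4 * card V + (2 ^ (h - m) + 2 ^ m) * (8 * card V + (h + 1)\<^sup>2) +
    ((m + 1)\<^sup>2 * 2 ^ (h + m) + (h - m + 1)\<^sup>2 * 2 ^ (h + (h - m)))) (\<lambda>E F. F = E)"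
    (is "finds P (_ + _ + ?c) _")
proof -
  have "finds P ((2 * card V + 2 ^ (h - m) * (5 * card V + (h + 1)\<^sup>2)) +
    ((2 * card V + 2 ^ m * (5 * card V + (h + 1)\<^sup>2)) +
     (card V * (3 * 2 ^ m + 3 * 2 ^ (h - m)) + ?c))) (\<lambda>E F. F = E)"
    by (rule finds_bind[OF finds_source_transversal[OF fam \<open>v \<in> V\<close> m]],
        rule finds_bind[OF finds_target_transversal[OF butterfly_family_subset[OF fam] \<open>v \<in> V\<close> m]],
        blast, rule finds_edges[OF butterfly_family_subset[OF fam] m]) auto
  then show ?thesis by (rule finds_mono) (simp add: algebra_simps)
qed

section \<open>Arithmetic of the query count, and the conclusion\<close>

lemma query_bound:
  fixes h :: nat
  assumes "0 < h"
  defines "m \<equiv> h div 2" and "n \<equiv> 2 ^ h * (h + 1)"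
  shows "real (4 * n + (2 ^ (h - m) + 2 ^ m) * (8 * n + (h + 1)\<^sup>2) +
    ((m + 1)\<^sup>2 * 2 ^ (h + m) + (h - m + 1)\<^sup>2 * 2 ^ (h + (h - m))))
    \<le> 192 * (2 powr (3 * real h / 2) * real h ^ 2)"
proof -
  \<comment> \<open>The larger of the two powers, as \<open>m\<close> is rounded down.\<close>
  define b :: nat where "b = 2 ^ (h - m)"
  have b: "2 ^ m \<le> b" "1 \<le> b" by (auto simp: b_def m_def)
  have "h + 1 \<le> 2 ^ h" by (induction h) auto
  then have n: "(h + 1)\<^sup>2 \<le> n" unfolding n_def power2_eq_square by (rule mult_right_mono) simp
  \<comment> \<open>Used with \<open>x = n * b\<close> and
    \<open>y = (h + 1)^2 * (2 ^ h * b)\<close>; the coefficient is 18 + 4 + 1 + 1.\<close>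
  have combine: "q \<le> 18 * x \<Longrightarrow> p \<le> 4 * x \<Longrightarrow> r \<le> y \<Longrightarrow> s \<le> y \<Longrightarrow> x \<le> y \<Longrightarrow>
      p + q + (r + s) \<le> 24 * y" for p q r s x y :: nat
    by linarith
  have "2 ^ (h - m) + 2 ^ m \<le> 2 * b" using b by (simp add: b_def)
  then have "(2 ^ (h - m) + 2 ^ m) * (8 * n + (h + 1)\<^sup>2) \<le> (2 * b) * (9 * n)"
    using n by (intro mult_mono) auto
  then have "(2 ^ (h - m) + 2 ^ m) * (8 * n + (h + 1)\<^sup>2) \<le> 18 * (n * b)"
    by (simp only: ac_simps)
  moreover have "4 * n \<le> 4 * (n * b)" using b by simp
  moreover have "(m + 1)\<^sup>2 * 2 ^ (h + m) \<le> (h + 1)\<^sup>2 * (2 ^ h * b)"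
    using b by (intro mult_mono power_mono) (auto simp: power_add m_def)
  moreover have "(h - m + 1)\<^sup>2 * 2 ^ (h + (h - m)) \<le> (h + 1)\<^sup>2 * (2 ^ h * b)"
    by (intro mult_mono power_mono) (auto simp: power_add b_def)
  moreover have "n * b \<le> (h + 1)\<^sup>2 * (2 ^ h * b)"
  proof -
    have "(h + 1) * (2 ^ h * b) \<le> (h + 1)\<^sup>2 * (2 ^ h * b)"
      by (intro mult_right_mono) (simp_all add: power2_eq_square)
    then show ?thesis by (simp add: n_def ac_simps)
  qed
  ultimately have "4 * n + (2 ^ (h - m) + 2 ^ m) * (8 * n + (h + 1)\<^sup>2) +
    ((m + 1)\<^sup>2 * 2 ^ (h + m) + (h - m + 1)\<^sup>2 * 2 ^ (h + (h - m))) \<le> 24 * ((h + 1)\<^sup>2 * (2 ^ h * b))"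
    by (rule combine)
  then have "real (4 * n + (2 ^ (h - m) + 2 ^ m) * (8 * n + (h + 1)\<^sup>2) +
    ((m + 1)\<^sup>2 * 2 ^ (h + m) + (h - m + 1)\<^sup>2 * 2 ^ (h + (h - m))))
    \<le> real (24 * ((h + 1)\<^sup>2 * (2 ^ h * b)))"
    by (simp only: of_nat_le_iff)
  also have "\<dots> = 24 * (real h + 1)\<^sup>2 * (2 powr real h * 2 powr real (h - m))"
    by (simp add: b_def powr_realpow algebra_simps)
  \<comment> \<open>Here \<open>h + 1 \<le> 2 * h\<close> uses \<open>0 < h\<close>, and rounding
    costs at most a factor 2 in \<open>b\<close>; this gives 24 * 4 * 2 = 192.\<close>
  also have "\<dots> \<le> 24 * (2 * real h)\<^sup>2 * (2 powr real h * (2 * 2 powr (real h / 2)))"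
  proof (intro mult_mono power_mono)
    have "real (h - m) \<le> 1 + real h / 2" by (simp add: m_def)
    then have "2 powr real (h - m) \<le> 2 powr (1 + real h / 2)" by simp
    then show "2 powr real (h - m) \<le> 2 * 2 powr (real h / 2)" by (simp add: powr_add)
  qed (use assms in auto)
  also have "\<dots> = 192 * (2 powr (3 * real h / 2) * real h ^ 2)"
    by (simp add: power2_eq_square flip: powr_add)
  finally show ?thesis .
qed

theorem theorem5:
  "\<exists>(A :: 'v set \<Rightarrow> 'v query_tree pmf) (q :: nat \<Rightarrow> real) (c :: real).
     c \<ge> 1 \<and>
     q \<in> O(\<lambda>h. 2 powr (3 * real h / 2) * real h ^ 2) \<and>
     (\<forall>h V E. butterfly_network h V E \<longrightarrow>
        measure_pmf.prob (A V)
          {T. tree_output (path_query E) T = E \<and> real (num_queries (path_query E) T) \<le> q h}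
        \<ge> 1 - 1 / real (card V) powr c)"
proof -
  define q :: "nat \<Rightarrow> real" where "q h = 192 * (2 powr (3 * real h / 2) * real h ^ 2)" for h
  \<comment> \<open>The tree may depend on \<open>V\<close> only, so it is chosen before
    \<open>h\<close> and \<open>E\<close>.\<close>
  have "\<exists>T. \<forall>h E. 0 < h \<longrightarrow> butterfly_network h V E \<longrightarrow>
      tree_output (path_query E) T = E \<and> real (num_queries (path_query E) T) \<le> q h" for V :: "'v set"
  proof (cases "\<exists>h>0. \<exists>E. butterfly_network h V E")
    case True
    then obtain h E0 where "0 < h" and E0: "butterfly_network h V E0" by blast
    have card_V: "card V = 2 ^ h * (h + 1)" using butterfly_network_card[OF E0] .
    \<comment> \<open>The height is not given to the algorithm but is determined by
      \<open>card V\<close>.\<close>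
    have uniq: "k = h" if "butterfly_network k V E" for k E
    proof -
      have sm: "strict_mono (\<lambda>k. 2 ^ k * (k + 1) :: nat)"
        by (intro strict_monoI mult_strict_mono power_strict_increasing) auto
      show ?thesis
        using butterfly_network_card[OF that] card_V strict_mono_eq[OF sm] by metis
    qed
    let ?P = "{E. butterfly_network h V E}"
    have "\<forall>E\<in>?P. \<exists>lev bits. butterfly_coords h V E lev bits"
      using butterfly_coords_exist unfolding butterfly_network_def by blast
    then obtain lev where "\<forall>E\<in>?P. \<exists>bits. butterfly_coords h V E (lev E) bits"
      using bchoice[of ?P "\<lambda>E lev. \<exists>bits. butterfly_coords h V E lev bits"] by blast
    then obtain bits where "\<forall>E\<in>?P. butterfly_coords h V E (lev E) (bits E)"
      using bchoice[of ?P "\<lambda>E bits. butterfly_coords h V E (lev E) bits"] by blast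
    moreover have "finite V" using E0 butterfly_finite_card unfolding butterfly_network_def by blast
    ultimately have fam: "butterfly_family h V ?P lev bits"
      by (simp add: butterfly_family_def)
    have "V \<noteq> {}" using card_V by auto
    then obtain v where "v \<in> V" by blast
    let ?k = "4 * card V + (2 ^ (h - h div 2) + 2 ^ (h div 2)) * (8 * card V + (h + 1)\<^sup>2) +
      ((h div 2 + 1)\<^sup>2 * 2 ^ (h + h div 2) + (h - h div 2 + 1)\<^sup>2 * 2 ^ (h + (h - h div 2)))"
    have "finds ?P ?k (\<lambda>E F. F = E)"
      by (rule finds_butterfly[OF fam _ \<open>v \<in> V\<close>]) simp
    \<comment> \<open>With \<open>Output\<close> as continuation, which asks nothing more, the
      obtained edge set becomes the output.\<close>
    from spec[OF this[unfolded finds_def], of Output]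
    obtain T where T: "\<forall>E\<in>?P. \<exists>F. F = E \<and>
        tree_output (path_query E) T = tree_output (path_query E) (Output F) \<and>
        num_queries (path_query E) T \<le> ?k + num_queries (path_query E) (Output F)"
      by blast
    have "tree_output (path_query E) T = E \<and> real (num_queries (path_query E) T) \<le> q h"
      if "butterfly_network h V E" for E
    proof -
      have E: "tree_output (path_query E) T = E" "num_queries (path_query E) T \<le> ?k"
        using T that by auto
      from E(2) have "real (num_queries (path_query E) T) \<le> real ?k"
        by (simp only: of_nat_le_iff)
      also have "\<dots> \<le> q h"
        unfolding q_def card_V by (rule query_bound[OF \<open>0 < h\<close>])
      finally show ?thesis using E(1) by simp
    qed
    then show ?thesis using uniq by blast
  qed blast
  then obtain A where A: "\<And>V :: 'v set. \<And>h E. 0 < h \<Longrightarrow> butterfly_network h V E \<Longrightarrow>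
      tree_output (path_query E) (A V) = E \<and> real (num_queries (path_query E) (A V)) \<le> q h"
    by metis
  show ?thesis
  \<comment> \<open>For positive height the point mass at \<open>A V\<close> succeeds with
    certainty, so \<open>c = 1\<close> suffices.\<close>
  proof (intro exI[of _ "\<lambda>V. return_pmf (A V)"] exI[of _ q] exI[of _ 1] conjI allI impI)
    show "q \<in> O(\<lambda>h. 2 powr (3 * real h / 2) * real h ^ 2)" unfolding q_def by simp
    fix h and V :: "'v set" and E assume net: "butterfly_network h V E"
    let ?G = "{T. tree_output (path_query E) T = E \<and> real (num_queries (path_query E) T) \<le> q h}"
    show "measure_pmf.prob (return_pmf (A V)) ?G \<ge> 1 - 1 / real (card V) powr 1"
    \<comment> \<open>At height 0 the required probability is \<open>1 - 1 / 1 = 0\<close>.\<close>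
    proof (cases "h = 0")
      case True
      then have "card V = 1" using butterfly_network_card[OF net] by simp
      then show ?thesis by simp
    next
      case False
      then have "A V \<in> ?G" using A net by simp
      then show ?thesis by (simp add: measure_return_pmf)
    qed
  qed simp
qed

end
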